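(* Let $D\geq 1$ be an integer. Every $\left(\frac{4D+3}{2(D+1)},\frac{1}{2(D+1)}\right)$-sparse multigraph $G$ has a $(D,\mathrm{F})$-coloring, i.e. a partition $(M,F)$ of $V(G)$ such that $G[M]$ is a forest with maximum degree at most $D$ and $G[F]$ is a forest.
   Context: All multigraphs are loopless. For $a>0$ and real $b$, a multigraph $H$ is $(a,b)$-sparse if it is loopless and for every $A\subseteq V(H)$ with $|A|\geq 2$, the induced subgraph $H[A]$ has at most $a|A|+b$ edges (counted with multiplicity). A forest is an acyclic multigraph; in particular a pair of parallel edges forms a cycle (a 2-cycle), so a forest has no multiple edges. *)

theory Defs
  imports Complex_Main
begin

record ('v, 'e) mgraph =
  verts :: "'v set"
  edges :: "'e set"
  ends :: "'e \<Rightarrow> 'v set"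

text \<open>
  Edges have an identity of their own, so parallel edges are distinct elements of the edge set with
  the same set of ends. Requiring exactly two ends makes every multigraph loopless.
\<close>

locale multigraph =
  fixes G :: "('v, 'e) mgraph"
  assumes finite_verts: "finite (verts G)"
    and finite_edges: "finite (edges G)"
    and ends_verts: "\<And>e. e \<in> edges G \<Longrightarrow> ends G e \<subseteq> verts G"
    and loopless: "\<And>e. e \<in> edges G \<Longrightarrow> card (ends G e) = 2"

definition induced :: "('v, 'e) mgraph \<Rightarrow> 'v set \<Rightarrow> ('v, 'e) mgraph" where
  "induced G A = \<lparr>verts = A, edges = {e \<in> edges G. ends G e \<subseteq> A}, ends = ends G\<rparr>"

text \<open>
  Looplessness is part of \<^locale>\<open>multigraph\<close> and is therefore not repeated here.
\<close>

definition sparse :: "real \<Rightarrow> real \<Rightarrow> ('v, 'e) mgraph \<Rightarrow> bool" where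
  "sparse a b G \<longleftrightarrow>
    (\<forall>A \<subseteq> verts G. card A \<ge> 2 \<longrightarrow>
      real (card (edges (induced G A))) \<le> a * real (card A) + b)"

definition degree :: "('v, 'e) mgraph \<Rightarrow> 'v \<Rightarrow> nat" where
  "degree G v = card {e \<in> edges G. v \<in> ends G e}"

definition max_degree_at_most :: "('v, 'e) mgraph \<Rightarrow> nat \<Rightarrow> bool" where
  "max_degree_at_most G d \<longleftrightarrow> (\<forall>v \<in> verts G. degree G v \<le> d)"

text \<open>
  The edge \<open>es ! i\<close> joins \<open>vs ! i\<close> to its cyclic successor. The edges are required to be distinct,
  so that a single edge is not a 2-cycle, whereas two parallel edges form one.
\<close>

definition is_cycle :: "('v, 'e) mgraph \<Rightarrow> 'v list \<Rightarrow> 'e list \<Rightarrow> bool" where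
  "is_cycle G vs es \<longleftrightarrow>
    vs \<noteq> [] \<and> length es = length vs \<and> distinct vs \<and> distinct es \<and>
    set vs \<subseteq> verts G \<and> set es \<subseteq> edges G \<and>
    (\<forall>i < length vs. ends G (es ! i) = {vs ! i, vs ! (Suc i mod length vs)})"

definition forest :: "('v, 'e) mgraph \<Rightarrow> bool" where
  "forest G \<longleftrightarrow> (\<nexists>vs es. is_cycle G vs es)"

text \<open>
  As usual for colorings, a class of the partition may be empty.
\<close>

definition is_DF_coloring :: "nat \<Rightarrow> ('v, 'e) mgraph \<Rightarrow> 'v set \<Rightarrow> 'v set \<Rightarrow> bool" where
  "is_DF_coloring D G M F \<longleftrightarrow>
    M \<union> F = verts G \<and> M \<inter> F = {} \<and>
    forest (induced G M) \<and> max_degree_at_most (induced G M) D \<and>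
    forest (induced G F)"

end

theory Submission
  imports Defs
begin

text \<open>
  The statement is proved for vertices \<open>v\<close> with a capacity \<open>c v \<in> {-1..D}\<close> bounding the degree of
  \<open>v\<close> in \<open>M\<close>, where \<open>-1\<close> forces \<open>v\<close> into \<open>F\<close>; sparsity becomes the condition that every vertex set
  has potential at least \<open>-1\<close>. In a minimal counterexample every nonempty proper vertex set \<open>W\<close> has
  potential at least \<open>2 * D + 1\<close>: otherwise color \<open>W\<close> first, contract \<open>W \<inter> F\<close> to one vertex of capacity
  \<open>-1\<close>, and let the outer neighbors of \<open>W \<inter> M\<close> pay with their capacities. This gap allows one to delete
  a vertex of degree 3 and lower the capacities of its neighbors, unless \<open>D = 1\<close> and the potential
  of the whole graph is exactly \<open>-1\<close>. In all other cases every vertex contributes at most \<open>-1\<close> to the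
  potential, which is absurd.

  For \<open>D = 1\<close> the class \<open>M\<close> is automatically a forest, which improves the gap to 4. Call the remaining
  vertices of degree 3 and capacity 1 cubic. They are independent, so they can form \<open>M\<close>
  unless the other vertices contain a cycle. Discharging from the cubic vertices shows that
  such a cycle is a double edge or a triangle; the former is reducible, and around the latter
  the coloring can be repaired.
\<close>

text \<open>In the potential of \<open>V\<close>, a vertex of capacity \<open>k\<close> and degree
  \<open>d\<close> counts \<open>2 * D + 3 + 2 * k - (D + 1) * d\<close>; for \<open>k = D\<close>
  this is \<open>D\<close> if \<open>d = 3\<close>, but \<open>-1\<close> if \<open>d = 4\<close>.
  Given the minimum degrees, only vertices of degree 3 with positive capacity can count more than
  \<open>-1\<close>. To delete such a vertex, its neighbors may each have to keep one unit of
  capacity in reserve. A unit costs 2, so a set containing three such neighbors must have potential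
  at least 5. The gap \<open>2 * D + 1\<close> is the potential of a single vertex of capacity
  \<open>-1\<close>: contracting a set of no larger potential to such a vertex does not lower the
  potential of the sets around it. It reaches 5 for \<open>D >= 2\<close> but not for
  \<open>D = 1\<close>, hence the long separate treatment of that case. The part of \<open>W\<close>
  in \<open>M\<close> cannot be merged like the part in \<open>F\<close>, because its vertices have
  separate remaining capacities. Outer neighbors pay instead, and acyclicity of \<open>M\<close>
  then limits the edges between its old and new parts: one edge is harmless, while for
  \<open>D = 1\<close> the degree bound alone excludes cycles.\<close>

section \<open>Weighted multiplicities and potentials\<close>

text \<open>Multigraphs up to the identity of their edges, as matrices: adding an edge or
  contracting a set only changes a function, and the vertex type stays fixed throughout the
  induction. Integer values avoid truncated subtraction in potentials.\<close>

definition multiplicity :: "('a \<Rightarrow> 'a \<Rightarrow> int) \<Rightarrow> bool" where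
  "multiplicity m \<longleftrightarrow> (\<forall>x y. m x y = m y x) \<and> (\<forall>x y. 0 \<le> m x y) \<and> (\<forall>x. m x x = 0)"

definition deg_in :: "('a \<Rightarrow> 'a \<Rightarrow> int) \<Rightarrow> 'a \<Rightarrow> 'a set \<Rightarrow> int" where
  "deg_in m v A = (\<Sum>y\<in>A. m v y)"

definition cross :: "('a \<Rightarrow> 'a \<Rightarrow> int) \<Rightarrow> 'a set \<Rightarrow> 'a set \<Rightarrow> int" where
  "cross m A B = (\<Sum>x\<in>A. deg_in m x B)"

text \<open>Every edge inside \<open>A\<close> is counted twice, once from each end.\<close>

definition deg_sum :: "('a \<Rightarrow> 'a \<Rightarrow> int) \<Rightarrow> 'a set \<Rightarrow> int" where
  "deg_sum m A = cross m A A"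

text \<open>Acyclicity by counting: each nonempty set spans fewer edges than it has vertices,
  doubled to match \<open>deg_sum\<close>. Gluing forests becomes addition of inequalities.\<close>

definition forest_on :: "('a \<Rightarrow> 'a \<Rightarrow> int) \<Rightarrow> 'a set \<Rightarrow> bool" where
  "forest_on m X \<longleftrightarrow> (\<forall>Y\<subseteq>X. Y \<noteq> {} \<longrightarrow> deg_sum m Y \<le> 2 * int (card Y) - 2)"

definition add_edge :: "'a \<Rightarrow> 'a \<Rightarrow> ('a \<Rightarrow> 'a \<Rightarrow> int) \<Rightarrow> 'a \<Rightarrow> 'a \<Rightarrow> int" where
  "add_edge p q m x y = m x y + of_bool (x = p \<and> y = q) + of_bool (x = q \<and> y = p)"

text \<open>
  A vertex of capacity \<open>D - i\<close> stands for a vertex that is adjacent to both ends of \<open>i\<close> separate double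
  edges: each of these has one end in \<open>M\<close>, and adding it changes the potential by \<open>-2\<close>.
\<close>

definition potential :: "int \<Rightarrow> ('a \<Rightarrow> 'a \<Rightarrow> int) \<Rightarrow> ('a \<Rightarrow> int) \<Rightarrow> 'a set \<Rightarrow> int" where
  "potential D m c A = (\<Sum>v\<in>A. 2 * D + 3 + 2 * c v) - (D + 1) * deg_sum m A"

definition coloring :: "'a set \<Rightarrow> ('a \<Rightarrow> 'a \<Rightarrow> int) \<Rightarrow> ('a \<Rightarrow> int) \<Rightarrow> 'a set \<Rightarrow> bool" where
  "coloring V m c M \<longleftrightarrow>
    M \<subseteq> V \<and> (\<forall>v\<in>M. deg_in m v M \<le> c v) \<and> forest_on m M \<and> forest_on m (V - M)"

lemma multiplicity_sym: "multiplicity m \<Longrightarrow> m x y = m y x"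
  and multiplicity_nonneg: "multiplicity m \<Longrightarrow> 0 \<le> m x y"
  and multiplicity_diag: "multiplicity m \<Longrightarrow> m x x = 0"
  by (auto simp: multiplicity_def)

lemma multiplicity_add_edge: "multiplicity m \<Longrightarrow> p \<noteq> q \<Longrightarrow> multiplicity (add_edge p q m)"
  by (auto simp: multiplicity_def add_edge_def)

lemma deg_in_empty [simp]: "deg_in m v {} = 0"
  by (simp add: deg_in_def)

lemma deg_in_insert [simp]:
  "finite A \<Longrightarrow> x \<notin> A \<Longrightarrow> deg_in m v (insert x A) = m v x + deg_in m v A"
  by (simp add: deg_in_def)

lemma deg_in_nonneg: "multiplicity m \<Longrightarrow> 0 \<le> deg_in m v A"
  by (auto simp: deg_in_def multiplicity_nonneg intro: sum_nonneg)

lemma deg_in_mono: "multiplicity m \<Longrightarrow> finite B \<Longrightarrow> A \<subseteq> B \<Longrightarrow> deg_in m v A \<le> deg_in m v B"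
  unfolding deg_in_def by (rule sum_mono2) (auto simp: multiplicity_nonneg)

lemma deg_in_Un:
  "finite A \<Longrightarrow> finite B \<Longrightarrow> A \<inter> B = {} \<Longrightarrow> deg_in m v (A \<union> B) = deg_in m v A + deg_in m v B"
  unfolding deg_in_def by (rule sum.union_disjoint)

lemma deg_in_split:
  "finite B \<Longrightarrow> A \<subseteq> B \<Longrightarrow> deg_in m v B = deg_in m v A + deg_in m v (B - A)"
  unfolding deg_in_def by (metis add.commute sum.subset_diff)

lemma deg_in_ge_mult: "multiplicity m \<Longrightarrow> finite A \<Longrightarrow> x \<in> A \<Longrightarrow> m v x \<le> deg_in m v A"
  unfolding deg_in_def by (rule member_le_sum) (auto simp: multiplicity_nonneg)

lemma deg_in_eq_0_iff:
  "multiplicity m \<Longrightarrow> finite A \<Longrightarrow> deg_in m v A = 0 \<longleftrightarrow> (\<forall>x\<in>A. m v x = 0)"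
  unfolding deg_in_def by (rule sum_nonneg_eq_0_iff) (auto simp: multiplicity_nonneg)

lemma deg_in_add_edge:
  assumes "finite A" "p \<noteq> q"
  shows "deg_in (add_edge p q m) v A =
    deg_in m v A + of_bool (v = p \<and> q \<in> A) + of_bool (v = q \<and> p \<in> A)"
proof -
  have "(\<Sum>y\<in>A. of_bool (v = a \<and> y = b)) = (of_bool (v = a \<and> b \<in> A) :: int)" for a b
    using assms(1) by (cases "v = a") (auto simp: of_bool_def)
  then show ?thesis by (simp add: deg_in_def add_edge_def sum.distrib)
qed

lemma cross_sym: 
  assumes "multiplicity m" shows "cross m A B = cross m B A"
  unfolding cross_def deg_in_def by (subst sum.swap) (simp add: multiplicity_sym[OF assms])

lemma cross_Un_right:
  assumes "finite B" "finite C" "B \<inter> C = {}"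
  shows "cross m A (B \<union> C) = cross m A B + cross m A C"
  by (simp add: cross_def deg_in_Un[OF assms] sum.distrib)

lemma cross_nonneg: "multiplicity m \<Longrightarrow> 0 \<le> cross m A B"
  unfolding cross_def by (rule sum_nonneg) (rule deg_in_nonneg)

lemma cross_eq_0_iff:
  "multiplicity m \<Longrightarrow> finite A \<Longrightarrow> cross m A B = 0 \<longleftrightarrow> (\<forall>x\<in>A. deg_in m x B = 0)"
  unfolding cross_def by (rule sum_nonneg_eq_0_iff) (auto simp: deg_in_nonneg)

lemma cross_mono:
  assumes "multiplicity m" "finite A'" "finite B'" "A \<subseteq> A'" "B \<subseteq> B'"
  shows "cross m A B \<le> cross m A' B'"
proof -
  have "cross m A B \<le> (\<Sum>x\<in>A. deg_in m x B')"
    unfolding cross_def by (rule sum_mono) (rule deg_in_mono[OF assms(1,3,5)])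
  also have "\<dots> \<le> cross m A' B'"
    unfolding cross_def by (rule sum_mono2) (auto simp: assms deg_in_nonneg)
  finally show ?thesis .
qed

lemma deg_sum_empty [simp]: "deg_sum m {} = 0"
  by (simp add: deg_sum_def cross_def)

lemma deg_sum_Un:
  assumes "multiplicity m" "finite A" "finite B" "A \<inter> B = {}"
  shows "deg_sum m (A \<union> B) = deg_sum m A + deg_sum m B + 2 * cross m A B"
proof -
  have "deg_sum m (A \<union> B) = cross m A (A \<union> B) + cross m B (A \<union> B)"
    unfolding deg_sum_def cross_def by (rule sum.union_disjoint) (use assms in auto)
  then show ?thesis
    using cross_sym[OF assms(1), of A B] by (simp add: cross_Un_right assms deg_sum_def)
qed

lemma deg_sum_insert:
  assumes "multiplicity m" "finite A" "v \<notin> A"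
  shows "deg_sum m (insert v A) = deg_sum m A + 2 * deg_in m v A"
  using deg_sum_Un[of m "{v}" A] assms
  by (simp add: cross_def deg_sum_def multiplicity_diag[OF assms(1)])

lemma deg_sum_add_edge:
  assumes "finite A" "p \<noteq> q"
  shows "deg_sum (add_edge p q m) A = deg_sum m A + 2 * of_bool (p \<in> A \<and> q \<in> A)"
proof -
  have "(\<Sum>v\<in>A. of_bool (v = a \<and> b \<in> A)) = (of_bool (a \<in> A \<and> b \<in> A) :: int)" for a b
    using assms(1) by (cases "b \<in> A") (auto simp: of_bool_def)
  then show ?thesis
    by (auto simp: deg_sum_def cross_def deg_in_add_edge[OF assms] sum.distrib of_bool_def)
qed

lemma potential_empty [simp]: "potential D m c {} = 0"
  by (simp add: potential_def)

lemma potential_Un: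
  assumes "multiplicity m" "finite A" "finite B" "A \<inter> B = {}"
  shows "potential D m c (A \<union> B) =
    potential D m c A + potential D m c B - (2 * D + 2) * cross m A B"
  by (simp add: potential_def deg_sum_Un[OF assms] sum.union_disjoint assms algebra_simps)

lemma potential_insert:
  assumes "multiplicity m" "finite A" "v \<notin> A"
  shows "potential D m c (insert v A) =
    potential D m c A + (2 * D + 3 + 2 * c v) - (2 * D + 2) * deg_in m v A"
  by (simp add: potential_def deg_sum_insert[OF assms] assms algebra_simps)

lemma potential_add_edge:
  assumes "finite A" "p \<noteq> q"
  shows "potential D (add_edge p q m) c A =
    potential D m c A - (2 * D + 2) * of_bool (p \<in> A \<and> q \<in> A)"
  by (simp add: potential_def deg_sum_add_edge[OF assms] algebra_simps)

text \<open>Truncation at \<open>-1\<close> keeps capacities in range and can only save potential,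
  so lowering costs at most 2 per unit.\<close>

lemma potential_lower_caps:
  assumes "\<And>v. v \<in> A \<Longrightarrow> - 1 \<le> c v \<and> 0 \<le> f v"
  shows "potential D m c A - 2 * sum f A \<le> potential D m (\<lambda>v. max (- 1) (c v - f v)) A"
proof -
  have "(\<Sum>v\<in>A. 2 * D + 3 + 2 * c v - 2 * f v) \<le> (\<Sum>v\<in>A. 2 * D + 3 + 2 * max (- 1) (c v - f v))"
    by (rule sum_mono) (auto simp: max_def)
  then show ?thesis by (simp add: potential_def sum_subtractf sum_distrib_left)
qed

lemma potential_sum_charge:
  "potential D m c V = (\<Sum>v\<in>V. 2 * D + 3 + 2 * c v - (D + 1) * deg_in m v V)"
  by (simp add: potential_def deg_sum_def cross_def sum_subtractf sum_distrib_left)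

section \<open>Forests under insertion of vertices and edges\<close>

lemma forest_on_empty [simp]: "forest_on m {}"
  by (simp add: forest_on_def)

text \<open>Subdivision: the edge \<open>pq\<close> is exchanged for the path \<open>p\<close>,
  \<open>v\<close>, \<open>q\<close>, or a part of it.\<close>

lemma forest_on_insert_edge:
  assumes m: "multiplicity m" and X: "finite X" "v \<notin> X" and pq: "p \<noteq> q"
    and F: "forest_on (add_edge p q m) X"
    and nb: "\<And>y. y \<in> X \<Longrightarrow> m v y \<le> of_bool (y = p) + of_bool (y = q)"
  shows "forest_on m (insert v X)"
  unfolding forest_on_def
proof (intro allI impI)
  fix Y assume Y: "Y \<subseteq> insert v X" "Y \<noteq> {}"
  define Z where "Z = Y - {v}"
  have Z: "Z \<subseteq> X" "finite Z" "v \<notin> Z" using Y X by (auto simp: Z_def intro: finite_subset)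
  have FZ: "deg_sum m Z + 2 * of_bool (p \<in> Z \<and> q \<in> Z) \<le> 2 * int (card Z) - 2" if "Z \<noteq> {}"
    using F Z that unfolding forest_on_def by (metis deg_sum_add_edge[OF Z(2) pq])
  show "deg_sum m Y \<le> 2 * int (card Y) - 2"
  proof (cases "v \<in> Y")
    case False
    then have "Y = Z" by (auto simp: Z_def)
    then show ?thesis using FZ Y by (simp add: of_bool_def split: if_splits)
  next
    case True
    then have YZ: "Y = insert v Z" by (auto simp: Z_def)
    have "deg_in m v Z \<le> (\<Sum>y\<in>Z. of_bool (y = p) + of_bool (y = q))"
      unfolding deg_in_def using nb Z(1) by (intro sum_mono) blast
    also have "\<dots> = of_bool (p \<in> Z) + of_bool (q \<in> Z)"
      using Z(2) by (simp add: sum.distrib of_bool_def)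
    finally have "deg_in m v Z \<le> of_bool (p \<in> Z) + of_bool (q \<in> Z)" .
    then show ?thesis
      using FZ deg_sum_insert[OF m Z(2,3)] Z
      by (cases "Z = {}") (auto simp: YZ of_bool_def split: if_splits)
  qed
qed

lemma forest_on_insert:
  assumes m: "multiplicity m" and X: "finite X" "v \<notin> X" and F: "forest_on m X"
    and d: "deg_in m v X \<le> 1"
  shows "forest_on m (insert v X)"
  unfolding forest_on_def
proof (intro allI impI)
  fix Y assume Y: "Y \<subseteq> insert v X" "Y \<noteq> {}"
  define Z where "Z = Y - {v}"
  have Z: "Z \<subseteq> X" "finite Z" "v \<notin> Z" using Y X by (auto simp: Z_def intro: finite_subset)
  have FZ: "deg_sum m Z \<le> 2 * int (card Z) - 2" if "Z \<noteq> {}"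
    using F Z that unfolding forest_on_def by blast
  show "deg_sum m Y \<le> 2 * int (card Y) - 2"
  proof (cases "v \<in> Y")
    case False
    then have "Y = Z" by (auto simp: Z_def)
    then show ?thesis using FZ Y by simp
  next
    case True
    then have YZ: "Y = insert v Z" by (auto simp: Z_def)
    have "deg_in m v Z \<le> 1" using deg_in_mono[OF m X(1) Z(1)] d by (rule order_trans)
    then show ?thesis
      using FZ deg_sum_insert[OF m Z(2,3)] Z by (cases "Z = {}") (auto simp: YZ)
  qed
qed

lemma forest_on_max_degree_1:
  assumes m: "multiplicity m" and X: "finite X" and d: "\<And>v. v \<in> X \<Longrightarrow> deg_in m v X \<le> 1"
  shows "forest_on m X"
  unfolding forest_on_def
proof (intro allI impI)
  fix Y assume Y: "Y \<subseteq> X" "Y \<noteq> {}"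
  have fY: "finite Y" using Y X by (auto intro: finite_subset)
  show "deg_sum m Y \<le> 2 * int (card Y) - 2"
  proof (cases "card Y = 1")
    case True
    then obtain y where "Y = {y}" by (auto simp: card_1_singleton_iff)
    then show ?thesis by (simp add: deg_sum_def cross_def multiplicity_diag[OF m])
  next
    case False
    then have "card Y \<ge> 2" using Y fY by (metis One_nat_def card_0_eq le_neq_implies_less less_one nat_less_le not_less_eq_eq numeral_2_eq_2 le0)
    moreover have "deg_sum m Y \<le> (\<Sum>x\<in>Y. 1)"
      unfolding deg_sum_def cross_def
      by (rule sum_mono) (use d deg_in_mono[OF m X Y(1)] Y in \<open>meson order_trans subsetD\<close>)
    ultimately show ?thesis by simp
  qed
qed

text \<open>The edge \<open>rs\<close> joins two components of a matching, distinct because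
  \<open>r\<close> and \<open>s\<close> are not adjacent. In counts: each edge between
  \<open>{r, s}\<close> and the rest \<open>W\<close> of \<open>Y\<close> uses up a vertex of
  \<open>W\<close>, so there are at most \<open>card W\<close> of them.\<close>

lemma forest_on_add_edge_max_degree_1:
  assumes m: "multiplicity m" and X: "finite X" and d: "\<And>v. v \<in> X \<Longrightarrow> deg_in m v X \<le> 1"
    and rs: "m r s = 0" "r \<noteq> s"
  shows "forest_on (add_edge r s m) X"
  unfolding forest_on_def
proof (intro allI impI)
  fix Y assume Y: "Y \<subseteq> X" "Y \<noteq> {}"
  have fY: "finite Y" using Y X by (auto intro: finite_subset)
  have dY: "deg_in m v Z \<le> 1" if "v \<in> Y" "Z \<subseteq> X" for v Z
    using deg_in_mono[OF m X that(2), of v] d[of v] that Y by force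
  show "deg_sum (add_edge r s m) Y \<le> 2 * int (card Y) - 2"
  proof (cases "r \<in> Y \<and> s \<in> Y")
    case False
    have "forest_on m X" by (rule forest_on_max_degree_1[OF m X d])
    then show ?thesis using Y False deg_sum_add_edge[OF fY rs(2), of m]
      by (auto simp: forest_on_def)
  next
    case True
    define W where "W = Y - {r, s}"
    have W: "Y = W \<union> {r, s}" "finite W" "W \<inter> {r, s} = {}" using True fY by (auto simp: W_def)
    have sr: "m s r = 0" using rs(1) multiplicity_sym[OF m] by metis
    have "deg_sum m {r, s} = 0"
      using rs sr multiplicity_diag[OF m] by (simp add: deg_sum_def cross_def)
    then have 1: "deg_sum m Y = deg_sum m W + 2 * cross m W {r, s}"
      using deg_sum_Un[OF m W(2) _ W(3)] W(1) by simp
    have "(\<Sum>w\<in>W. deg_in m w Y) \<le> (\<Sum>w\<in>W. 1)"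
      by (rule sum_mono) (use dY Y W in auto)
    also have "(\<Sum>w\<in>W. deg_in m w Y) = deg_sum m W + cross m W {r, s}"
      using cross_Un_right[OF W(2) _ W(3), of m W] W(1) by (simp add: deg_sum_def cross_def)
    finally have 2: "deg_sum m W + cross m W {r, s} \<le> int (card W)" by simp
    have 3: "cross m W {r, s} \<le> 2"
    proof -
      have "cross m W {r, s} = deg_in m r W + deg_in m s W"
        using cross_sym[OF m, of W "{r, s}"] rs(2) by (simp add: cross_def[of m "{r, s}"])
      then show ?thesis using dY[of r W] dY[of s W] True W Y by auto
    qed
    have 4: "cross m W {r, s} \<le> int (card W)"
      using 2 cross_nonneg[OF m, of W W] by (simp add: deg_sum_def)
    have "card Y = card W + 2" using W rs(2) by (simp add: card_Un_disjoint)
    moreover have "deg_sum (add_edge r s m) Y = deg_sum m Y + 2"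
      using deg_sum_add_edge[OF fY rs(2), of m] True by simp
    moreover have "cross m W {r, s} = 0" if "card W = 0" using that W(2) by (simp add: cross_def)
    ultimately show ?thesis using 1 2 3 4 by linarith
  qed
qed

section \<open>Potential gaps in a minimal counterexample\<close>

text \<open>Minimality concerns the number of vertices alone, so smaller instances may have new
  edges and arbitrary capacities; \<open>D\<close> never changes.\<close>

locale minimal_counterexample =
  fixes V :: "'a set" and m :: "'a \<Rightarrow> 'a \<Rightarrow> int" and c :: "'a \<Rightarrow> int" and D :: int
  assumes fin: "finite V"
    and mult: "multiplicity m"
    and D_pos: "1 \<le> D"
    and caps: "\<And>v. v \<in> V \<Longrightarrow> - 1 \<le> c v \<and> c v \<le> D"
    and sparse: "\<And>A. A \<subseteq> V \<Longrightarrow> - 1 \<le> potential D m c A"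
    and not_colorable: "\<And>M. \<not> coloring V m c M"
    and smaller_colorable: "\<And>(V' :: 'a set) m' c'. card V' < card V \<Longrightarrow> finite V' \<Longrightarrow> multiplicity m' \<Longrightarrow>
      (\<And>v. v \<in> V' \<Longrightarrow> - 1 \<le> c' v \<and> c' v \<le> D) \<Longrightarrow>
      (\<And>A. A \<subseteq> V' \<Longrightarrow> A \<noteq> {} \<Longrightarrow> - 1 \<le> potential D m' c' A) \<Longrightarrow> \<exists>M. coloring V' m' c' M"
begin

abbreviation pot :: "'a set \<Rightarrow> int" where "pot \<equiv> potential D m c"
abbreviation deg :: "'a \<Rightarrow> 'a set \<Rightarrow> int" where "deg \<equiv> deg_in m"

lemma finite_sub: "A \<subseteq> V \<Longrightarrow> finite A"
  using fin by (rule rev_finite_subset)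

lemma m_sym: "m x y = m y x" and m_nonneg: "0 \<le> m x y" and m_diag [simp]: "m x x = 0"
  using mult by (auto simp: multiplicity_def)

lemmas deg_nonneg = deg_in_nonneg[OF mult]

lemma pot_insert:
  "finite A \<Longrightarrow> v \<notin> A \<Longrightarrow> pot (insert v A) = pot A + (2 * D + 3 + 2 * c v) - (2 * D + 2) * deg v A"
  by (rule potential_insert[OF mult])

text \<open>
  Extending a coloring of a part \<open>W\<close>. The class \<open>F\<close> of \<open>W\<close> is contracted to one vertex \<open>f\<close> with
  capacity \<open>-1\<close>; a vertex outside \<open>W\<close> pays for each edge to the class \<open>M\<close> of \<open>W\<close> with its
  capacity.
\<close>

lemma extend_coloring:
  assumes W: "W \<subset> V" "2 \<le> card W" and colW: "coloring W m c MW"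
    and c'_range: "\<And>v. v \<in> V - W \<Longrightarrow> - 1 \<le> c' v \<and> c' v \<le> c v"
    and c'_cost: "\<And>v. v \<in> V - W \<Longrightarrow> 2 * (c v - c' v) \<le> (2 * D + 2) * deg v MW"
    and c'_deg: "\<And>v. v \<in> V - W \<Longrightarrow> 0 \<le> c' v \<Longrightarrow> c' v + deg v MW \<le> c v"
    and MW_deg: "\<And>w. w \<in> MW \<Longrightarrow> deg w MW + deg w {v \<in> V - W. 0 \<le> c' v} \<le> c w"
    and acyc: "cross m {v \<in> V - W. 0 \<le> c' v} MW \<le> 1 \<or> D = 1"
    and potW: "pot W \<le> 2 * D + 2 + pot V"
    and slack: "pot W \<le> pot V + 1 + (2 * D + 2) * cross m (V - W) (W - MW)
        + (\<Sum>v\<in>V - W. (2 * D + 2) * deg v MW - 2 * (c v - c' v))"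
    and above: "\<And>A. W \<subseteq> A \<Longrightarrow> A \<subset> V \<Longrightarrow> pot W - 1 \<le> pot A"
  shows False
proof -
  define R where "R = V - W"
  define FW where "FW = W - MW"
  have MW: "MW \<subseteq> W" "forest_on m MW" "forest_on m FW"
    using colW by (auto simp: coloring_def FW_def)
  have fins: "finite R" "finite W" "finite MW" "finite FW"
    using fin W MW by (auto simp: R_def FW_def dest: finite_subset psubset_imp_subset)
  have VRW: "V = W \<union> R" "W \<inter> R = {}" using W by (auto simp: R_def)
  have WMF: "W = MW \<union> FW" "MW \<inter> FW = {}" using MW by (auto simp: FW_def)
  obtain f where f: "f \<in> W" using W(2) by fastforce
  have fR: "f \<notin> R" using f by (simp add: R_def)
  \<comment> \<open>The contracted vertex borrows the name of some \<open>f\<close> in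
    \<open>W\<close>; its multiplicities merge the edges to \<open>FW\<close>, and edges to
    \<open>MW\<close> are dropped.\<close>
  define m' where "m' = (\<lambda>x y. if x = f then (if y \<in> R then deg y FW else 0)
      else if y = f then (if x \<in> R then deg x FW else 0) else m x y)"
  define c2 where "c2 = c'(f := - 1)"
  have mult': "multiplicity m'"
    using mult fR by (auto simp: multiplicity_def m'_def deg_nonneg)
  have deg': "deg_in m' v A = deg v A" if "v \<in> R" "A \<subseteq> R" for v A
    unfolding deg_in_def by (rule sum.cong) (use that fR in \<open>auto simp: m'_def\<close>)
  have degf: "deg_in m' f A = cross m A FW" if "A \<subseteq> R" for A
    unfolding cross_def deg_in_def[of m' f] by (rule sum.cong) (use that fR in \<open>auto simp: m'_def\<close>)
  have ds': "deg_sum m' A = deg_sum m A" if "A \<subseteq> R" for A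
    unfolding deg_sum_def cross_def using that by (intro sum.cong) (auto intro: deg')
  \<comment> \<open>What is left of the \<open>2 * D + 2\<close> gained for each dropped edge from
    \<open>v\<close> to \<open>MW\<close> after the lowering of the capacity of \<open>v\<close> is
    paid.\<close>
  define slk where "slk = (\<lambda>v. (2 * D + 2) * deg v MW - 2 * (c v - c' v))"
  have slk0: "0 \<le> slk v" if "v \<in> R" for v using c'_cost that by (auto simp: slk_def R_def)
  have potR: "potential D m' c2 A
      = pot (A \<union> W) - pot W + (2 * D + 2) * cross m A FW + sum slk A" if A: "A \<subseteq> R" for A
  proof -
    have fA: "finite A" using A fins by (auto intro: finite_subset)
    have "potential D m' c2 A = (\<Sum>v\<in>A. 2 * D + 3 + 2 * c' v) - (D + 1) * deg_sum m A"
      using A fR unfolding potential_def ds'[OF A] c2_def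
      by (intro arg_cong2[where f = minus] sum.cong refl) auto
    also have "\<dots> = pot A - (\<Sum>v\<in>A. 2 * (c v - c' v))"
      by (simp add: potential_def sum.distrib sum_subtractf sum_distrib_left algebra_simps)
    also have "\<dots> = pot A - (2 * D + 2) * cross m A MW + sum slk A"
      by (simp add: slk_def cross_def sum_subtractf sum_distrib_left)
    finally have 1: "potential D m' c2 A = pot A - (2 * D + 2) * cross m A MW + sum slk A" .
    have "A \<inter> W = {}" using A by (auto simp: R_def)
    with fA have "pot (A \<union> W) = pot A + pot W - (2 * D + 2) * cross m A W"
      by (intro potential_Un mult fins) auto
    moreover have "cross m A W = cross m A MW + cross m A FW"
      using cross_Un_right[OF fins(3,4) WMF(2), of m A] WMF(1) by simp
    ultimately show ?thesis using 1 by (simp add: algebra_simps)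
  qed
  have cr0: "0 \<le> (2 * D + 2) * cross m A B" for A B
    using D_pos cross_nonneg[OF mult] by simp
  have sl0: "0 \<le> sum slk A" if "A \<subseteq> R" for A using that slk0 by (intro sum_nonneg) auto
  have AW: "pot W - 1 \<le> pot (A \<union> W)" if "A \<subseteq> R" "A \<noteq> R" for A
    using that W by (intro above) (auto simp: R_def)
  have 1: "- 1 \<le> potential D m' c2 A" if A: "A \<subseteq> R" for A
  proof (cases "A = R")
    case True
    then have "A \<union> W = V" using VRW by auto
    then show ?thesis using potR[OF A] slack True by (simp add: slk_def R_def FW_def)
  next
    case False
    then show ?thesis using potR[OF A] AW[OF A] cr0[of A FW] sl0[OF A] by linarith
  qed
  \<comment> \<open>Adding \<open>f\<close> charges the edges to \<open>FW\<close> again, so their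
    term in \<open>potR\<close> cancels, and brings in the potential \<open>2 * D + 1\<close> of a
    vertex of capacity \<open>-1\<close>.\<close>
  have 2: "- 1 \<le> potential D m' c2 (insert f A)" if A: "A \<subseteq> R" for A
  proof -
    have "f \<notin> A" using A fR by auto
    then have "potential D m' c2 (insert f A)
        = potential D m' c2 A + (2 * D + 1) - (2 * D + 2) * cross m A FW"
      using potential_insert[OF mult' finite_subset[OF A fins(1)], of f D c2]
      by (simp add: degf[OF A] c2_def)
    then have *: "potential D m' c2 (insert f A) = pot (A \<union> W) - pot W + sum slk A + (2 * D + 1)"
      using potR[OF A] by simp
    show ?thesis
    proof (cases "A = R")
      case True
      then have "A \<union> W = V" using VRW by auto
      then show ?thesis using * potW sl0[OF A] by simp
    next
      case False
      then show ?thesis using * AW[OF A] sl0[OF A] D_pos by linarith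
    qed
  qed
  have "\<exists>M. coloring (insert f R) m' c2 M"
  proof (rule smaller_colorable)
    have "card V = card W + card R" using VRW fins card_Un_disjoint by metis
    then show "card (insert f R) < card V" using W fins fR by simp
    show "- 1 \<le> c2 v \<and> c2 v \<le> D" if "v \<in> insert f R" for v
    proof (cases "v = f")
      case True
      then show ?thesis using D_pos by (simp add: c2_def)
    next
      case False
      then have "v \<in> V - W" using that by (auto simp: R_def)
      then show ?thesis using caps[of v] c'_range[of v] False by (simp add: c2_def)
    qed
    show "- 1 \<le> potential D m' c2 A" if A: "A \<subseteq> insert f R" for A
    proof (cases "f \<in> A")
      case True
      then have "A = insert f (A - {f})" "A - {f} \<subseteq> R" using A by auto
      then show ?thesis using 2 by metis
    next
      case False
      then show ?thesis using 1 A by auto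
    qed
  qed (use mult' fins in auto)
  then obtain M where M: "coloring (insert f R) m' c2 M" by blast
  have "f \<notin> M"
  proof
    assume "f \<in> M"
    then have "deg_in m' f M \<le> - 1" using M by (auto simp: coloring_def c2_def)
    then show False using deg_in_nonneg[OF mult'] by (metis neg_0_le_iff_le not_one_le_zero order_trans)
  qed
  then have MR: "M \<subseteq> R" using M by (auto simp: coloring_def)
  then have fM: "finite M" using fins by (auto intro: finite_subset)
  have degM: "deg v M \<le> c' v" if "v \<in> M" for v
  proof -
    have "v \<in> R" "v \<noteq> f" using that MR fR by auto
    then show ?thesis using M deg'[OF _ MR, of v] that by (auto simp: coloring_def c2_def)
  qed
  define R0 where "R0 = {v \<in> V - W. 0 \<le> c' v}"
  have MR0: "M \<subseteq> R0"
    using MR order_trans[OF deg_nonneg degM] by (auto simp: R0_def R_def)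
  have R0: "R0 \<subseteq> R" "finite R0" using fins by (auto simp: R0_def R_def)
  have MWM: "MW \<inter> M = {}" using MW MR VRW by auto
  have deg_MW_M: "deg v (MW \<union> M) = deg v MW + deg v M" for v
    by (rule deg_in_Un) (use fins fM MWM in auto)
  have forM: "forest_on m M"
    unfolding forest_on_def
  proof (intro allI impI)
    fix Y assume Y: "Y \<subseteq> M" "Y \<noteq> {}"
    then have "deg_sum m' Y \<le> 2 * int (card Y) - 2" using M by (auto simp: coloring_def forest_on_def)
    then show "deg_sum m Y \<le> 2 * int (card Y) - 2" using ds'[of Y] Y MR by auto
  qed
  have "deg v (MW \<union> M) \<le> c v" if v: "v \<in> MW \<union> M" for v
  proof (cases "v \<in> M")
    case True
    then have "v \<in> V - W" "0 \<le> c' v" using MR0 by (auto simp: R0_def)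
    then show ?thesis using degM[OF True] c'_deg[of v] deg_MW_M[of v] by simp
  next
    case False
    then have "deg v MW + deg v R0 \<le> c v" using v MW_deg by (auto simp: R0_def)
    moreover have "deg v M \<le> deg v R0" by (rule deg_in_mono[OF mult R0(2) MR0])
    ultimately show ?thesis by (simp add: deg_MW_M)
  qed
  note degs = this
  \<comment> \<open>A single edge between two forests closes no cycle. For \<open>D = 1\<close> any
    number of edges is allowed, because the degrees are at most 1.\<close>
  have forM2: "forest_on m (MW \<union> M)"
    using acyc
  proof
    assume "D = 1"
    show ?thesis
    proof (rule forest_on_max_degree_1[OF mult])
      fix v assume v: "v \<in> MW \<union> M"
      then have "v \<in> V" using MW MR VRW by auto
      then show "deg v (MW \<union> M) \<le> 1" using degs[OF v] caps[of v] \<open>D = 1\<close> by simp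
    qed (use fins fM in auto)
  next
    assume cr: "cross m {v \<in> V - W. 0 \<le> c' v} MW \<le> 1"
    show ?thesis
      unfolding forest_on_def
    proof (intro allI impI)
      fix Y assume Y: "Y \<subseteq> MW \<union> M" "Y \<noteq> {}"
      define A B where "A = Y \<inter> MW" and "B = Y \<inter> M"
      have AB: "Y = B \<union> A" "B \<inter> A = {}" "finite A" "finite B"
        using Y(1) MWM unfolding A_def B_def by (blast, blast, simp add: fins, simp add: fM)
      have "cross m B A \<le> cross m R0 MW"
        by (rule cross_mono[OF mult]) (use R0 fins MR0 in \<open>auto simp: A_def B_def\<close>)
      then have "cross m B A \<le> 1" using cr by (simp add: R0_def)
      moreover have "deg_sum m A \<le> 2 * int (card A) - 2" if "A \<noteq> {}"
        using MW(2) that by (auto simp: forest_on_def A_def)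
      moreover have "deg_sum m B \<le> 2 * int (card B) - 2" if "B \<noteq> {}"
        using forM that by (auto simp: forest_on_def B_def)
      moreover have "deg_sum m Y = deg_sum m B + deg_sum m A + 2 * cross m B A"
        "card Y = card B + card A"
        unfolding AB(1) by (rule deg_sum_Un[OF mult AB(4,3,2)], rule card_Un_disjoint[OF AB(4,3,2)])
      moreover have "cross m B A = 0" if "A = {} \<or> B = {}"
        using that by (auto simp: cross_def)
      ultimately show "deg_sum m Y \<le> 2 * int (card Y) - 2"
        using Y(2) AB(1) by (cases "A = {}"; cases "B = {}") simp_all
    qed
  qed
  have "forest_on m (FW \<union> (R - M))"
    unfolding forest_on_def
  proof (intro allI impI)
    fix Y assume Y: "Y \<subseteq> FW \<union> (R - M)" "Y \<noteq> {}"
    define A B where "A = Y \<inter> FW" and "B = Y \<inter> (R - M)"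
    have "FW \<inter> R = {}" by (auto simp: FW_def R_def)
    then have AB: "Y = B \<union> A" "B \<inter> A = {}" "finite A" "finite B"
      using Y(1) unfolding A_def B_def by (blast, blast, simp add: fins, simp add: fins)
    have BR: "B \<subseteq> R" "f \<notin> B" using fR by (auto simp: B_def)
    have dY: "deg_sum m Y = deg_sum m B + deg_sum m A + 2 * cross m B A"
      "card Y = card B + card A"
      unfolding AB(1) by (rule deg_sum_Un[OF mult AB(4,3,2)], rule card_Un_disjoint[OF AB(4,3,2)])
    have forF: "forest_on m' (insert f R - M)" using M by (auto simp: coloring_def)
    have dA: "deg_sum m A \<le> 2 * int (card A) - 2" if "A \<noteq> {}"
      using MW(3) that by (simp add: forest_on_def A_def)
    have "B \<subseteq> insert f R - M" by (auto simp: B_def)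
    then have "deg_sum m' B \<le> 2 * int (card B) - 2" if "B \<noteq> {}"
      using forF that by (simp add: forest_on_def)
    then have dB: "deg_sum m B \<le> 2 * int (card B) - 2" if "B \<noteq> {}"
      using ds'[OF BR(1)] that by simp
    \<comment> \<open>With \<open>f\<close> included, \<open>B\<close> has at most
      \<open>card B\<close> edges inside it or to \<open>FW\<close>; adding the bound
      \<open>card A - 1\<close> for \<open>A\<close> gives that of a forest on
      \<open>Y\<close>.\<close>
    have "insert f B \<subseteq> insert f R - M" using \<open>f \<notin> M\<close> by (auto simp: B_def)
    then have "deg_sum m' (insert f B) \<le> 2 * int (card (insert f B)) - 2"
      using forF by (simp add: forest_on_def)
    then have "deg_sum m B + 2 * cross m B FW \<le> 2 * int (card B)"
      using deg_sum_insert[OF mult' AB(4) BR(2)] degf[OF BR(1)] ds'[OF BR(1)] BR(2) AB(4) by simp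
    moreover have "cross m B A \<le> cross m B FW"
      by (rule cross_mono[OF mult]) (use AB fins in \<open>auto simp: A_def\<close>)
    ultimately have "deg_sum m B + 2 * cross m B A \<le> 2 * int (card B)" by simp
    moreover have "cross m B A = 0" if "A = {}" using that by (simp add: cross_def)
    ultimately show "deg_sum m Y \<le> 2 * int (card Y) - 2"
      using Y(2) AB(1) dA dB dY by (cases "A = {}") simp_all
  qed
  moreover have "FW \<union> (R - M) = V - (MW \<union> M)" 
    using MR MW(1) W(1) unfolding FW_def R_def by blast
  ultimately have "coloring V m c (MW \<union> M)"
    using degs forM2 MW(1) MR W(1) by (auto simp: coloring_def R_def)
  then show False using not_colorable by blast
qed


section \<open>Choosing the capacities outside an already colored part\<close>

lemma V_nonempty: "V \<noteq> {}"
proof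
  assume "V = {}"
  then have "coloring V m c {}" by (simp add: coloring_def)
  then show False using not_colorable by blast
qed

text \<open>\<open>f v\<close> is capacity held in reserve for neighbors that join \<open>M\<close>
  later. A vertex that cannot afford its reserve is forced into \<open>F\<close>, so the inequality
  for \<open>M\<close> holds without truncation.\<close>

lemma reduce:
  assumes V': "V' \<subset> V" and m': "multiplicity m'" and f: "\<And>v. 0 \<le> f v"
    and s: "\<And>A. A \<subseteq> V' \<Longrightarrow> A \<noteq> {} \<Longrightarrow> 2 * sum f A - 1 \<le> potential D m' c A"
  obtains M where "M \<subseteq> V'" "\<And>v. v \<in> M \<Longrightarrow> deg_in m' v M + f v \<le> c v"
    "forest_on m' M" "forest_on m' (V' - M)"
proof -
  let ?c' = "\<lambda>v. max (- 1) (c v - f v)"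
  have "\<exists>M. coloring V' m' ?c' M"
  proof (rule smaller_colorable)
    show "card V' < card V" using V' fin by (rule psubset_card_mono[rotated])
    show "- 1 \<le> ?c' v \<and> ?c' v \<le> D" if "v \<in> V'" for v
      using caps[of v] f[of v] V' that D_pos by auto
    show "- 1 \<le> potential D m' ?c' A" if A: "A \<subseteq> V'" "A \<noteq> {}" for A
    proof -
      have "potential D m' c A - 2 * sum f A \<le> potential D m' ?c' A"
        using A V' caps f by (intro potential_lower_caps) auto
      then show ?thesis using s[OF A] by linarith
    qed
  qed (use V' fin m' in \<open>auto intro: finite_subset\<close>)
  then obtain M where M: "coloring V' m' ?c' M" by blast
  moreover have "deg_in m' v M + f v \<le> c v" if "v \<in> M" for v
  proof -
    have "deg_in m' v M \<le> max (- 1) (c v - f v)" using M that by (simp add: coloring_def)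
    then show ?thesis using deg_in_nonneg[OF m', of v M] by linarith
  qed
  ultimately show ?thesis using that by (auto simp: coloring_def)
qed

lemma potential_split:
  assumes "W \<subseteq> A" "A \<subseteq> V"
  shows "pot A = pot W + pot (A - W) - (2 * D + 2) * cross m W (A - W)"
proof -
  have "finite W" "finite (A - W)" "A = W \<union> (A - W)"
    using assms fin by (auto intro: finite_subset)
  then show ?thesis using potential_Un[OF mult, of W "A - W" D c] by auto
qed

text \<open>Without edges leaving \<open>W\<close>, potentials are additive over \<open>W\<close>
  and its complement, so \<open>extend_coloring\<close> works with unchanged capacities.\<close>

lemma connected:
  assumes W: "W \<subset> V" "2 \<le> card W"
  shows "\<exists>v\<in>V - W. 0 < deg v W"
proof (rule ccontr)
  assume "\<not> ?thesis"
  then have 0: "deg v W = 0" if "v \<in> V - W" for v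
    using that deg_nonneg[of v W] by force
  have fW: "finite W" using W fin by (auto intro: finite_subset)
  obtain MW where MW: "MW \<subseteq> W" "\<And>v. v \<in> MW \<Longrightarrow> deg v MW + 0 \<le> c v"
    "forest_on m MW" "forest_on m (W - MW)"
    by (rule reduce[OF W(1) mult, of "\<lambda>_. 0"]) (use sparse W in auto)
  have m0: "m v w = 0" if "v \<in> V - W" "w \<in> W" for v w
    using 0[OF that(1)] that(2) deg_in_eq_0_iff[OF mult fW] by blast
  have d0: "deg v A = 0" if "v \<in> V - W" "A \<subseteq> W" for v A
    unfolding deg_in_def using that m0 by (intro sum.neutral) auto
  have d0': "deg w {v \<in> V - W. 0 \<le> c v} = 0" if "w \<in> W" for w
    unfolding deg_in_def using that m0 m_sym by (intro sum.neutral) auto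
  have cr: "cross m B W = 0" if "B \<subseteq> V - W" for B
    unfolding cross_def using that 0 by (intro sum.neutral) auto
  have pw: "pot A = pot W + pot (A - W)" if "W \<subseteq> A" "A \<subseteq> V" for A
  proof -
    have "cross m W (A - W) = 0" using cr[of "A - W"] that cross_sym[OF mult] by auto
    then show ?thesis using potential_split[OF that] by simp
  qed
  show False
  proof (rule extend_coloring[OF W, of MW c])
    show "coloring W m c MW" using MW by (auto simp: coloring_def)
    show "pot W - 1 \<le> pot A" if "W \<subseteq> A" "A \<subset> V" for A
      using pw[of A] sparse[of "A - W"] that by auto
    show "pot W \<le> 2 * D + 2 + pot V"
      using pw[of V] sparse[of "V - W"] W D_pos by auto
    show "pot W \<le> pot V + 1 + (2 * D + 2) * cross m (V - W) (W - MW) +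
        (\<Sum>v\<in>V - W. (2 * D + 2) * deg v MW - 2 * (c v - c v))"
      using pw[of V] sparse[of "V - W"] W d0 MW(1) by (auto simp: cross_def)
    show "cross m {v \<in> V - W. 0 \<le> c v} MW \<le> 1 \<or> D = 1"
      using d0 MW(1) by (auto simp: cross_def)
  qed (use caps d0 d0' MW W in auto)
qed

text \<open>Outer neighbors of \<open>MW\<close> are banned from \<open>M\<close>, except those in
  \<open>X\<close>, which lose one unit. A ban costs at most \<open>2 * D + 2\<close>, exactly what
  one edge to \<open>MW\<close> refunds. Savings come from three sources: a member of
  \<open>X\<close> saves \<open>2 * D\<close>, while an edge to the other class of \<open>W\<close>
  or a second edge to \<open>MW\<close> saves \<open>2 * D + 2\<close>. One source must cover
  \<open>pot W\<close>.\<close>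

lemma extend_by_boundary:
  assumes W: "W \<subset> V" "2 \<le> card W" and MW: "coloring W m c MW"
    and X: "X \<subseteq> V - W" "\<And>v. v \<in> X \<Longrightarrow> deg v MW = 1" "card X \<le> 1 \<or> D = 1"
    and XM: "\<And>w. w \<in> MW \<Longrightarrow> deg w MW + deg w X \<le> c w"
    and potW: "pot W \<le> 2 * D + 1"
    and slack: "1 \<le> cross m (V - W) (W - MW) \<or> pot W \<le> 2 * D * int (card X) \<or>
      (\<exists>v\<in>V - W. 2 \<le> deg v MW)"
    and above: "\<And>A. W \<subseteq> A \<Longrightarrow> A \<subset> V \<Longrightarrow> pot W - 1 \<le> pot A"
  shows False
proof -
  have sub: "MW \<subseteq> W" using MW by (auto simp: coloring_def)
  have fins: "finite W" "finite MW" "finite (V - W)" "finite X"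
    using fin W sub X(1) by (auto dest: finite_subset psubset_imp_subset)
  define c' where "c' = (\<lambda>v. if deg v MW = 0 then c v else if v \<in> X then max (- 1) (c v - 1) else - 1)"
  have deg1: "1 \<le> deg v MW" if "deg v MW \<noteq> 0" for v using that deg_nonneg[of v MW] by simp
  have slk: "2 * D * of_bool (v \<in> X) \<le> (2 * D + 2) * deg v MW - 2 * (c v - c' v)"
    if v: "v \<in> V - W" for v
  proof (cases "v \<in> X")
    case True
    then show ?thesis using X(2)[OF True] D_pos by (auto simp: c'_def max_def)
  next
    case False
    show ?thesis
    proof (cases "deg v MW = 0")
      case False
      have "2 * D + 2 \<le> (2 * D + 2) * deg v MW"
        using mult_left_mono[of 1 "deg v MW" "2 * D + 2"] deg1[OF False] D_pos by simp
      then show ?thesis using False \<open>v \<notin> X\<close> caps[of v] v by (simp add: c'_def)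
    qed (use \<open>v \<notin> X\<close> in \<open>simp add: c'_def\<close>)
  qed
  define S where "S = {v \<in> V - W. 0 \<le> c' v}"
  have S: "deg v MW = 0" if "v \<in> S" "v \<notin> X" for v
    using that by (auto simp: S_def c'_def split: if_splits)
  have fS: "finite S" using fin by (simp add: S_def)
  have SX: "deg w S \<le> deg w X" if "w \<in> MW" for w
  proof -
    have "deg w S = deg w (S \<inter> X) + deg w (S - S \<inter> X)" using deg_in_split[OF fS] by blast
    moreover have "deg w (S - S \<inter> X) = 0"
      unfolding deg_in_def
    proof (rule sum.neutral, rule ballI)
      fix v assume "v \<in> S - S \<inter> X"
      then have "m v w = 0" using S deg_in_eq_0_iff[OF mult fins(2)] that by blast
      then show "m w v = 0" by (metis m_sym)
    qed
    ultimately show ?thesis using deg_in_mono[OF mult fins(4), of "S \<inter> X" w] by simp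
  qed
  have crS: "cross m S MW \<le> int (card X)"
  proof -
    have "cross m S MW \<le> (\<Sum>v\<in>S. of_bool (v \<in> X))"
      unfolding cross_def by (rule sum_mono) (use S X(2) in force)
    also have "\<dots> = int (card (S \<inter> X))" using fS by (simp add: of_bool_def sum.If_cases Int_def)
    also have "\<dots> \<le> int (card X)" using fins by (simp add: card_mono)
    finally show ?thesis .
  qed
  have sums: "2 * D * int (card X) \<le> (\<Sum>v\<in>V - W. (2 * D + 2) * deg v MW - 2 * (c v - c' v))"
  proof -
    have "(\<Sum>v\<in>V - W. 2 * D * of_bool (v \<in> X)) = 2 * D * int (card ((V - W) \<inter> X))"
      using fins by (simp add: sum_distrib_left[symmetric] of_bool_def sum.If_cases Int_def)
    also have "(V - W) \<inter> X = X" using X(1) by auto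
    finally have "2 * D * int (card X) = (\<Sum>v\<in>V - W. 2 * D * of_bool (v \<in> X))" by (rule sym)
    also have "\<dots> \<le> (\<Sum>v\<in>V - W. (2 * D + 2) * deg v MW - 2 * (c v - c' v))"
      by (rule sum_mono) (rule slk)
    finally show ?thesis .
  qed
  define CR where "CR = (2 * D + 2) * cross m (V - W) (W - MW)"
  define SL where "SL = (\<Sum>v\<in>V - W. (2 * D + 2) * deg v MW - 2 * (c v - c' v))"
  have cr0: "0 \<le> CR"
    using D_pos cross_nonneg[OF mult] by (simp add: CR_def)
  have sums: "2 * D * int (card X) \<le> SL" using sums unfolding SL_def .
  have potV: "- 1 \<le> pot V" by (rule sparse) simp
  show False
  proof (rule extend_coloring[OF W MW, of c'])
    fix v assume v: "v \<in> V - W"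
    show "- 1 \<le> c' v \<and> c' v \<le> c v" using caps[of v] v by (auto simp: c'_def)
    have "0 \<le> 2 * D * of_bool (v \<in> X)" using D_pos by simp
    then show "2 * (c v - c' v) \<le> (2 * D + 2) * deg v MW" using slk[OF v] by linarith
    show "c' v + deg v MW \<le> c v" if "0 \<le> c' v"
      using that X(2)[of v] by (auto simp: c'_def split: if_splits)
  next
    fix w assume "w \<in> MW"
    then show "deg w MW + deg w {v \<in> V - W. 0 \<le> c' v} \<le> c w"
      using XM[of w] SX[of w] by (simp add: S_def)
  next
    show "cross m {v \<in> V - W. 0 \<le> c' v} MW \<le> 1 \<or> D = 1"
      using crS X(3) by (auto simp: S_def)
    show "pot W \<le> 2 * D + 2 + pot V" using potV potW by linarith
    have nn: "0 \<le> 2 * D * int (card X)" using D_pos by simp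
    have sl0: "0 \<le> SL" using nn sums by (rule order_trans)
    from slack have "pot W \<le> pot V + 1 + CR + SL"
    proof (elim disjE bexE)
      assume "1 \<le> cross m (V - W) (W - MW)"
      then have "2 * D + 2 \<le> CR"
        using mult_left_mono[of 1 _ "2 * D + 2"] D_pos by (simp add: CR_def)
      then show ?thesis using potV potW sl0 by linarith
    next
      assume "pot W \<le> 2 * D * int (card X)"
      then have "pot W \<le> SL" using sums by (rule order_trans)
      then show ?thesis using potV cr0 by linarith
    next
      fix v assume v: "v \<in> V - W" "2 \<le> deg v MW"
      have s0: "0 \<le> (2 * D + 2) * deg u MW - 2 * (c u - c' u)" if "u \<in> V - W" for u
      proof -
        have "0 \<le> 2 * D * of_bool (u \<in> X)" using D_pos by simp
        then show ?thesis using slk[OF that] by linarith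
      qed
      have "4 * D + 4 \<le> (2 * D + 2) * deg v MW"
        using mult_left_mono[of 2 "deg v MW" "2 * D + 2"] v D_pos by simp
      moreover have "c v - c' v \<le> D + 1" using caps[of v] v D_pos by (auto simp: c'_def)
      ultimately have "2 * D + 2 \<le> (2 * D + 2) * deg v MW - 2 * (c v - c' v)"
        by (simp add: algebra_simps)
      also have "\<dots> \<le> SL"
        unfolding SL_def by (rule member_le_sum) (use v s0 fins in auto)
      finally show ?thesis using potV potW cr0 by linarith
    qed
    then show "pot W \<le> pot V + 1 + (2 * D + 2) * cross m (V - W) (W - MW) +
        (\<Sum>v\<in>V - W. (2 * D + 2) * deg v MW - 2 * (c v - c' v))"
      unfolding CR_def SL_def .
  qed (use above in auto)
qed

text \<open>
  \<open>X\<close> is a set of vertices outside \<open>W\<close> that may join \<open>M\<close> although they have a neighbor in \<open>M \<inter> W\<close>: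
  their neighbors in \<open>W\<close> are colored with correspondingly lower capacities.
\<close>

lemma low_potential_boundary:
  assumes W: "W \<subset> V" "2 \<le> card W"
    and X: "X \<subseteq> V - W" "\<And>v. v \<in> X \<Longrightarrow> 0 < deg v W" "card X \<le> 1 \<or> D = 1"
    and low: "\<And>A. A \<subseteq> W \<Longrightarrow> A \<noteq> {} \<Longrightarrow> 2 * int (card X) - 1 \<le> pot A"
    and potW: "pot W \<le> 2 * D + 1" "pot W \<le> 2 * D * int (card X) \<or> (\<exists>v\<in>V - W. 2 \<le> deg v W)"
    and above: "\<And>A. W \<subseteq> A \<Longrightarrow> A \<subset> V \<Longrightarrow> pot W - 1 \<le> pot A"
  shows False
proof -
  have fW: "finite W" "finite (V - W)" "finite X"
    using W fin X(1) by (auto intro: finite_subset)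
  \<comment> \<open>A vertex with two edges to \<open>W\<close> saves enough by itself, whichever
    classes they end in, so no exception from the ban is made then. Otherwise every member of
    \<open>X\<close> has exactly one edge to \<open>W\<close>, and the reserves in \<open>W\<close>
    amount to \<open>card X\<close> units.\<close>
  define Y where "Y = (if \<exists>v\<in>V - W. 2 \<le> deg v W then {} else X)"
  have Y: "Y \<subseteq> V - W" "card Y \<le> card X" "Y \<subseteq> X" using X(1) by (auto simp: Y_def)
  have Y1: "deg v W = 1" if "v \<in> Y" for v
    using that X(2)[of v] Y(1) by (force simp: Y_def split: if_splits)
  obtain MW where MW: "MW \<subseteq> W" "\<And>v. v \<in> MW \<Longrightarrow> deg v MW + deg v Y \<le> c v"
    "forest_on m MW" "forest_on m (W - MW)"
  proof (rule reduce[OF W(1) mult, of "\<lambda>w. deg w Y"])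
    fix A assume A: "A \<subseteq> W" "A \<noteq> {}"
    have "(\<Sum>w\<in>A. deg w Y) = cross m Y A" by (simp add: cross_def[symmetric] cross_sym[OF mult])
    also have "\<dots> \<le> cross m Y W"
      by (rule cross_mono[OF mult]) (use A Y fW in \<open>auto intro: finite_subset\<close>)
    also have "\<dots> = int (card Y)" using Y1 by (simp add: cross_def)
    finally show "2 * (\<Sum>w\<in>A. deg w Y) - 1 \<le> pot A" using low[OF A] Y(2) by linarith
  qed (use deg_nonneg in auto)
  have col: "coloring W m c MW"
    unfolding coloring_def
  proof (intro conjI ballI)
    fix v assume "v \<in> MW"
    then show "deg v MW \<le> c v" using MW(2)[of v] deg_nonneg[of v Y] by linarith
  qed (use MW in auto)
  have split: "deg v W = deg v MW + deg v (W - MW)" for v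
    by (rule deg_in_split[OF fW(1) MW(1)])
  show False
  proof (cases "cross m (V - W) (W - MW) = 0")
    case False
    then have 1: "1 \<le> cross m (V - W) (W - MW)"
      using cross_nonneg[OF mult, of "V - W" "W - MW"] by linarith
    show False
      by (rule extend_by_boundary[OF W col, of "{}"]) (use 1 col potW above in \<open>auto simp: coloring_def\<close>)
  next
    case True
    then have 0: "deg v MW = deg v W" if "v \<in> V - W" for v
      using cross_eq_0_iff[OF mult fW(2)] split[of v] that by auto
    have "pot W \<le> 2 * D * int (card Y) \<or> (\<exists>v\<in>V - W. 2 \<le> deg v MW)"
      using potW(2) 0 by (auto simp: Y_def)
    then show False
      by (intro extend_by_boundary[OF W col Y(1) _ _ MW(2)]) (use 0 Y Y1 X(3) potW(1) above in auto)
  qed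
qed

section \<open>Lower bounds for the potential of proper subsets\<close>

lemma pot_singleton: "pot {v} = 2 * D + 3 + 2 * c v"
  by (simp add: potential_def deg_sum_def cross_def)

text \<open>For a set \<open>W\<close> of least potential, the conditions on its subsets and
  supersets hold automatically. If \<open>pot W\<close> is at most 0, no saving is required.
  Otherwise \<open>pot W >= 1\<close> pays for the one reserved unit that exempts an outer neighbor,
  and the exemption saves \<open>2 * D\<close>.\<close>

lemma potential_gap:
  assumes "A \<subset> V" "A \<noteq> {}"
  shows "2 * D + 1 \<le> pot A"
proof (rule ccontr)
  assume less: "\<not> ?thesis"
  have "finite {A. A \<subset> V \<and> A \<noteq> {}}" using fin by (auto intro: finite_subset[of _ "Pow V"])
  then obtain W where "is_arg_min pot (\<lambda>A. A \<in> {A. A \<subset> V \<and> A \<noteq> {}}) W"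
    using ex_is_arg_min_if_finite[of "{A. A \<subset> V \<and> A \<noteq> {}}" pot] assms by blast
  then have W: "W \<subset> V" "W \<noteq> {}" and min: "\<And>A. A \<subset> V \<Longrightarrow> A \<noteq> {} \<Longrightarrow> pot W \<le> pot A"
    by (auto simp: is_arg_min_linorder)
  have pW: "pot W \<le> 2 * D" using min[OF assms] less by simp
  have fW: "finite W" using W fin by (auto intro: finite_subset)
  have "card W \<noteq> 1"
  proof
    assume "card W = 1"
    then obtain v where "W = {v}" by (auto simp: card_1_singleton_iff)
    then show False using pW caps[of v] W pot_singleton[of v] by auto
  qed
  then have c2: "2 \<le> card W" using W(2) fW card_gt_0_iff[of W] by linarith
  have ab: "pot W - 1 \<le> pot A" if "W \<subseteq> A" "A \<subset> V" for A using min[of A] that W by force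
  have low: "pot W \<le> pot A" if "A \<subseteq> W" "A \<noteq> {}" for A using min[of A] that W by blast
  obtain v where v: "v \<in> V - W" "0 < deg v W" using connected[OF W(1) c2] by blast
  show False
  proof (cases "pot W \<le> 0")
    case True
    show False
      by (rule low_potential_boundary[OF W(1) c2, of "{}"])
        (use True ab D_pos sparse W in \<open>auto simp: subset_iff\<close>)
  next
    case False
    show False
    proof (rule low_potential_boundary[OF W(1) c2, of "{v}"])
      show "pot W \<le> 2 * D * int (card {v}) \<or> (\<exists>v\<in>V - W. 2 \<le> deg v W)" using pW by simp
      show "2 * int (card {v}) - 1 \<le> pot A" if "A \<subseteq> W" "A \<noteq> {}" for A
        using low[OF that] False by simp
    qed (use v pW ab in auto)
  qed
qed

text \<open>If \<open>pot W = 3\<close>, the gap for the complement and \<open>pot V = - 1\<close>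
  force at least two edges between \<open>W\<close> and its complement. They meet either one outer
  vertex twice or two outer vertices, and for \<open>D = 1\<close> both of these may be exempted:
  the two reserved units need potential 3, the saving is 4.\<close>

lemma potential_gap_4:
  assumes D: "D = 1" and V: "pot V = - 1" and W: "W \<subset> V" "2 \<le> card W"
  shows "4 \<le> pot W"
proof (rule ccontr)
  assume less: "\<not> ?thesis"
  have fW: "finite W" "finite (V - W)" using W fin by (auto intro: finite_subset)
  have ne: "W \<noteq> {}" using W by auto
  have gap: "3 \<le> pot A" if "A \<subset> V" "A \<noteq> {}" for A using potential_gap[OF that] D by simp
  have pW: "pot W = 3" using gap[OF W(1) ne] less by simp
  have low: "3 \<le> pot A" if "A \<subseteq> W" "A \<noteq> {}" for A using gap[of A] that W by blast
  have ab: "pot W - 1 \<le> pot A" if "W \<subseteq> A" "A \<subset> V" for A using gap[of A] that ne pW by force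
  define B where "B = {v \<in> V - W. 0 < deg v W}"
  show False
  proof (cases "(\<exists>v\<in>V - W. 2 \<le> deg v W)")
    case True
    show False
      by (rule low_potential_boundary[OF W, of "{}"])
        (use True ab D sparse W pW in \<open>auto simp: subset_iff\<close>)
  next
    case False
    have "pot V = pot W + pot (V - W) - 4 * cross m (V - W) W"
      using potential_split[of W V] W D cross_sym[OF mult] by auto
    moreover have "3 \<le> pot (V - W)" using gap[of "V - W"] W ne by auto
    ultimately have cr: "2 \<le> cross m (V - W) W" using V pW by linarith
    have "cross m (V - W) W \<le> (\<Sum>v\<in>V - W. of_bool (v \<in> B))"
      unfolding cross_def by (rule sum_mono) (use False in \<open>force simp: B_def\<close>)
    also have "\<dots> = int (card ((V - W) \<inter> B))" using fW by (simp add: of_bool_def sum.If_cases Int_def)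
    also have "(V - W) \<inter> B = B" by (auto simp: B_def)
    finally have "2 \<le> card B" using cr by simp
    then obtain X where X: "X \<subseteq> B" "card X = 2" by (metis obtain_subset_with_card_n)
    show False
      by (rule low_potential_boundary[OF W, of X])
        (use X D low ab pW in \<open>auto simp: B_def\<close>)
  qed
qed


section \<open>Vertices of small degree\<close>

lemma not_extendable_to_F:
  assumes V: "V = insert v V'" "v \<notin> V'" and M: "M \<subseteq> V'" "forest_on m M" "forest_on m (V' - M)"
    and degs: "\<And>w. w \<in> M \<Longrightarrow> deg w M \<le> c w"
  shows "2 \<le> deg v (V' - M)"
proof (rule ccontr)
  assume "\<not> ?thesis"
  moreover have "finite V'" using fin V by simp
  ultimately have "forest_on m (insert v (V' - M))"
    using M V(2) by (intro forest_on_insert[OF mult]) auto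
  moreover have "insert v (V' - M) = V - M" using V M(1) by auto
  ultimately have "coloring V m c M" using M degs V by (auto simp: coloring_def)
  then show False using not_colorable by blast
qed

lemma not_extendable_to_M:
  assumes V: "V = insert v V'" "v \<notin> V'" and M: "M \<subseteq> V'" "forest_on m M" "forest_on m (V' - M)"
    and degs: "\<And>w. w \<in> M \<Longrightarrow> deg w M + m w v \<le> c w" and v: "deg v M \<le> c v"
  shows "2 \<le> deg v M"
proof (rule ccontr)
  assume *: "\<not> ?thesis"
  have fM: "finite M" "v \<notin> M" using fin V M(1) by (auto intro: finite_subset)
  have "forest_on m (insert v M)"
    using M fM * by (intro forest_on_insert[OF mult]) auto
  moreover have "V' - M = V - insert v M" using V M(1) by auto
  moreover have "deg w (insert v M) \<le> c w" if "w \<in> insert v M" for w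
    using that degs[of w] v fM by (auto simp: add.commute)
  ultimately have "coloring V m c (insert v M)" using M V by (auto simp: coloring_def)
  then show False using not_colorable by blast
qed

lemma deg_remove: "v \<in> V \<Longrightarrow> deg v (V - {v}) = deg v V"
  using deg_in_insert[of "V - {v}" v m v] fin by (simp add: insert_absorb)

text \<open>After coloring the rest, \<open>v\<close> must have two edges to \<open>F\<close>. If
  these are all its edges, \<open>v\<close> has no neighbor in \<open>M\<close> and can join
  \<open>M\<close> unless its capacity is \<open>-1\<close>.\<close>

lemma min_degree:
  assumes v: "v \<in> V"
  shows "(if 0 \<le> c v then 3 else 2) \<le> deg v V"
proof (rule ccontr)
  assume less: "\<not> ?thesis"
  let ?V = "V - {v}"
  have V: "V = insert v ?V" "v \<notin> ?V" using v by auto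
  obtain M where M: "M \<subseteq> ?V" "\<And>w. w \<in> M \<Longrightarrow> deg w M + 0 \<le> c w"
    "forest_on m M" "forest_on m (?V - M)"
    by (rule reduce[of ?V m "\<lambda>_. 0"]) (use sparse mult v in \<open>auto simp: subset_iff\<close>)
  have split: "deg v V = deg v M + deg v (?V - M)"
    using deg_in_split[of ?V M m v] fin M(1) deg_remove[OF v] by simp
  have F: "2 \<le> deg v (?V - M)"
    by (rule not_extendable_to_F[OF V]) (use M in auto)
  then have c: "0 \<le> c v" and M0: "deg v M = 0"
    using less split deg_nonneg[of v M] by (simp_all split: if_splits)
  have "finite M" using M(1) by (intro finite_sub) auto
  then have "m v w = 0" if "w \<in> M" for w
    using M0 that deg_in_eq_0_iff[OF mult, of M v] by blast
  then have "m w v = 0" if "w \<in> M" for w using that m_sym by metis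
  then have "2 \<le> deg v M"
    by (intro not_extendable_to_M[OF V]) (use M M0 c in auto)
  then show False using M0 by simp
qed

text \<open>With two of its three edges going to \<open>F\<close>, \<open>v\<close> has at most one
  neighbor in \<open>M\<close> and could join \<open>M\<close> if that neighbor has a unit in
  reserve. Only neighbors in \<open>N\<close> need one: a double edge cannot lead to
  \<open>M\<close> here, and capacity \<open>-1\<close> means \<open>F\<close>. The conclusion
  describes the only case in which these reserves are too expensive.\<close>

lemma degree_3_vertex:
  assumes v: "v \<in> V" "1 \<le> c v" "deg v V = 3"
  shows "D = 1 \<and> pot V = - 1 \<and> card {y \<in> V. m v y = 1 \<and> 0 \<le> c y} = 3"
proof (rule ccontr)
  assume contra: "\<not> ?thesis"
  let ?V = "V - {v}"
  define N where "N = {y \<in> V. m v y = 1 \<and> 0 \<le> c y}"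
  have V: "V = insert v ?V" "v \<notin> ?V" using v by auto
  have fN: "finite N" using fin by (simp add: N_def)
  have cardN: "int (card (A \<inter> N)) \<le> deg v A" if "A \<subseteq> V" for A
  proof -
    have "int (card (A \<inter> N)) = (\<Sum>y\<in>A \<inter> N. m v y)" by (simp add: N_def)
    also have "\<dots> = deg v (A \<inter> N)" by (simp add: deg_in_def)
    also have "\<dots> \<le> deg v A" by (rule deg_in_mono[OF mult]) (use that finite_sub in auto)
    finally show ?thesis .
  qed
  obtain M where M: "M \<subseteq> ?V" "\<And>w. w \<in> M \<Longrightarrow> deg w M + of_bool (w \<in> N) \<le> c w"
    "forest_on m M" "forest_on m (?V - M)"
  proof (rule reduce[of ?V m "\<lambda>w. of_bool (w \<in> N)"])
    fix A assume A: "A \<subseteq> ?V" "A \<noteq> {}"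
    have fA: "finite A" "v \<notin> A" "A \<subseteq> V" using A finite_sub[of A] by auto
    have gap: "2 * D + 1 \<le> pot A" using A v by (intro potential_gap) auto
    have sumf: "(\<Sum>w\<in>A. of_bool (w \<in> N)) = int (card (A \<inter> N))"
      using fA by (simp add: of_bool_def sum.If_cases Int_def)
    have dA: "deg v A \<le> 3" using deg_in_mono[OF mult fin fA(3), of v] v by simp
    have "2 * int (card (A \<inter> N)) - 1 \<le> pot A"
    proof (cases "card (A \<inter> N) \<le> 2")
      case True
      then show ?thesis using gap D_pos by linarith
    next
      \<comment> \<open>Three units need potential 5. Comparison with \<open>insert v A\<close>
        yields at least \<open>2 * D + 2\<close>, and one more than that for \<open>D = 1\<close>
        unless \<open>insert v A\<close> has potential \<open>-1\<close>; by the gap it is then all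
        of \<open>V\<close>.\<close>
      case False
      have d3: "deg v A = 3" "card (A \<inter> N) = 3" using cardN[OF fA(3)] False dA by linarith+
      have ins: "pot (insert v A) = pot A + (2 * D + 3 + 2 * c v) - (6 * D + 6)"
        using pot_insert[OF fA(1,2)] d3 by simp
      have "V \<inter> N = N" by (auto simp: N_def)
      then have "card N \<le> 3" using cardN[of V] v(3) by simp
      then have "card N = 3" using d3 fN card_mono[of N "A \<inter> N"] by simp
      then have D1: "D \<noteq> 1 \<or> pot V \<noteq> - 1" using contra by (auto simp: N_def)
      have vA: "insert v A \<subseteq> V" using v fA by auto
      show ?thesis
      proof (cases "D = 1")
        case True
        have "0 \<le> pot (insert v A)"
        proof (cases "insert v A = V")
          case True
          then show ?thesis using D1 \<open>D = 1\<close> sparse[OF vA] by auto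
        next
          case False
          then show ?thesis using potential_gap[of "insert v A"] vA D_pos by (simp add: psubset_eq)
        qed
        then show ?thesis using True ins d3 caps[OF v(1)] by simp
      next
        case False
        then show ?thesis using D_pos ins d3 sparse[OF vA] caps[OF v(1)] by simp
      qed
    qed
    then show "2 * (\<Sum>w\<in>A. of_bool (w \<in> N)) - 1 \<le> pot A" by (simp only: sumf)
  qed (use mult v in auto)
  have degs: "deg w M \<le> c w" if "w \<in> M" for w using M(2)[OF that] by (simp add: of_bool_def split: if_splits)
  have split: "deg v V = deg v M + deg v (?V - M)"
    using deg_in_split[of ?V M m v] fin M(1) deg_remove[OF v(1)] by simp
  have F: "2 \<le> deg v (?V - M)"
    by (rule not_extendable_to_F[OF V M(1,3,4) degs])
  then have M1: "deg v M \<le> 1" using split v by simp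
  have "deg w M + m w v \<le> c w" if w: "w \<in> M" for w
  proof (cases "m v w = 0")
    case True
    then show ?thesis using degs[OF w] by (simp add: m_sym)
  next
    case False
    have "finite M" using M(1) by (intro finite_sub) auto
    then have "m v w \<le> deg v M" using w by (intro deg_in_ge_mult[OF mult])
    then have "m v w = 1" using False M1 m_nonneg[of v w] by simp
    moreover have "0 \<le> c w" using degs[OF w] deg_nonneg[of w M] by simp
    ultimately have "w \<in> N" using w M(1) by (auto simp: N_def)
    then show ?thesis using M(2)[OF w] \<open>m v w = 1\<close> by (simp add: m_sym)
  qed
  then have "2 \<le> deg v M"
    by (intro not_extendable_to_M[OF V M(1,3,4)]) (use M1 v in auto)
  then show False using M1 by simp
qed

section \<open>Contributions of single vertices to the potential\<close>

abbreviation charge :: "'a \<Rightarrow> int" where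
  "charge v \<equiv> 2 * D + 3 + 2 * c v - (D + 1) * deg v V"

text \<open>The extreme cases are capacity \<open>-1\<close> with degree 2, capacity 0 with degree
  3, and capacity \<open>D\<close> with degree 4; they give \<open>-1\<close>, \<open>-D\<close> and
  \<open>-1\<close>.\<close>

lemma charge_le:
  assumes v: "v \<in> V" and n3: "\<not> (1 \<le> c v \<and> deg v V = 3)"
  shows "charge v \<le> - 1"
proof -
  have D: "0 \<le> D + 1" using D_pos by simp
  have c: "- 1 \<le> c v" "c v \<le> D" using caps[OF v] by auto
  consider "c v = - 1" "2 \<le> deg v V" | "c v = 0" "3 \<le> deg v V" | "4 \<le> deg v V"
    using min_degree[OF v] n3 c by (auto split: if_splits)
  then show ?thesis
  proof cases
    case 1
    then show ?thesis using mult_left_mono[OF 1(2) D] D_pos by (simp add: algebra_simps)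
  next
    case 2
    then show ?thesis using mult_left_mono[OF 2(2) D] D_pos by (simp add: algebra_simps)
  next
    case 3
    then show ?thesis using mult_left_mono[OF 3 D] D_pos c by (simp add: algebra_simps)
  qed
qed

lemma D_eq_1: "D = 1" and pot_V: "pot V = - 1"
proof -
  have "D = 1 \<and> pot V = - 1"
  proof (rule ccontr)
    assume contra: "\<not> ?thesis"
    \<comment> \<open>Charges of at most \<open>-1\<close> with a sum of at least \<open>-1\<close>
      leave a single vertex, which has degree 0.\<close>
    have "charge v \<le> - 1" if "v \<in> V" for v
      using charge_le[OF that] degree_3_vertex[OF that] contra by blast
    then have "pot V \<le> (\<Sum>v\<in>V. - 1)"
      unfolding potential_sum_charge by (rule sum_mono)
    then have "card V \<le> 1" using sparse[of V] by simp
    moreover obtain v where v: "v \<in> V" using V_nonempty by blast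
    ultimately have "V = {v}"
      using fin by (auto simp: card_le_Suc0_iff_eq)
    then show False using min_degree[OF v] by (simp split: if_splits)
  qed
  then show "D = 1" "pot V = - 1" by auto
qed


section \<open>Reducible configurations for \<open>D = 1\<close>\<close>

lemma gap3: "A \<subset> V \<Longrightarrow> A \<noteq> {} \<Longrightarrow> 3 \<le> pot A"
  using potential_gap[of A] D_eq_1 by simp

lemma gap4: "A \<subset> V \<Longrightarrow> 2 \<le> card A \<Longrightarrow> 4 \<le> pot A"
  using potential_gap_4 D_eq_1 pot_V by blast

lemma caps_1: "v \<in> V \<Longrightarrow> c v \<le> 1"
  using caps D_eq_1 by auto

lemma pot_insert_1:
  "finite A \<Longrightarrow> v \<notin> A \<Longrightarrow> pot (insert v A) = pot A + 5 + 2 * c v - 4 * deg v A"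
  using pot_insert D_eq_1 by simp

section \<open>Cubic vertices and partial colorings\<close>

definition neighbors :: "'a \<Rightarrow> 'a set \<Rightarrow> bool" where
  "neighbors v S \<longleftrightarrow> S \<subseteq> V \<and> (\<forall>y\<in>V. m v y = (if y \<in> S then 1 else 0))"

definition cubic :: "'a \<Rightarrow> bool" where
  "cubic v \<longleftrightarrow> v \<in> V \<and> c v = 1 \<and> deg v V = 3"

lemma deg_neighbors: "neighbors v S \<Longrightarrow> A \<subseteq> V \<Longrightarrow> deg v A = int (card (A \<inter> S))"
  using finite_sub[of A]
  by (auto simp: neighbors_def deg_in_def of_bool_def sum.If_cases Int_def subset_iff
      intro!: sum.cong[THEN trans])

lemma neighborsD: "neighbors v S \<Longrightarrow> y \<in> V \<Longrightarrow> m v y = (if y \<in> S then 1 else 0)"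
  and neighbors_sub: "neighbors v S \<Longrightarrow> S \<subseteq> V"
  by (auto simp: neighbors_def)

lemma neighbors_irrefl:
  assumes "neighbors v S" shows "v \<notin> S"
proof
  assume "v \<in> S"
  then have "m v v = (if v \<in> S then 1 else 0)" using neighborsD[OF assms] neighbors_sub[OF assms] by blast
  then show False using \<open>v \<in> S\<close> by simp
qed

lemma cubicD: "cubic v \<Longrightarrow> v \<in> V" "cubic v \<Longrightarrow> c v = 1"
  by (auto simp: cubic_def)

lemma cubic_neighbors:
  assumes "cubic v"
  obtains S where "neighbors v S" "card S = 3" "\<And>y. y \<in> S \<Longrightarrow> 0 \<le> c y"
proof -
  define S where "S = {y \<in> V. m v y = 1 \<and> 0 \<le> c y}"
  have v: "v \<in> V" "1 \<le> c v" "deg v V = 3" using assms by (auto simp: cubic_def)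
  have S: "card S = 3" using degree_3_vertex[OF v] by (simp add: S_def)
  have "deg v S = (\<Sum>y\<in>S. 1)" unfolding deg_in_def by (rule sum.cong) (auto simp: S_def)
  then have dS: "deg v S = 3" using S by simp
  have "deg v V = deg v S + deg v (V - S)"
    by (rule deg_in_split) (auto simp: S_def fin)
  then have "deg v (V - S) = 0" using dS v by simp
  then have "m v y = 0" if "y \<in> V - S" for y
    using deg_in_eq_0_iff[OF mult, of "V - S" v] fin that by auto
  then have "neighbors v S" by (auto simp: neighbors_def S_def)
  then show ?thesis using that S by (auto simp: S_def)
qed

lemma cubic_other_neighbors:
  assumes v: "cubic v" and x: "x \<in> V" "m v x \<noteq> 0"
  obtains p q where "neighbors v {x, p, q}" "distinct [v, x, p, q]" "p \<in> V" "q \<in> V"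
proof -
  obtain S where S: "neighbors v S" "card S = 3" using cubic_neighbors[OF v] .
  have "x \<in> S" using neighborsD[OF S(1) x(1)] x(2) by (auto split: if_splits)
  then have "card (S - {x}) = 2" using S(2) by simp
  then obtain p q where pq: "S - {x} = {p, q}" "p \<noteq> q" by (auto simp: card_2_iff)
  have "S = {x, p, q}" using pq \<open>x \<in> S\<close> by auto
  then show ?thesis
    using that[of p q] S(1) pq neighbors_irrefl[OF S(1)] neighbors_sub[OF S(1)] by auto
qed

lemma cubic_neighbor_cap:
  assumes "cubic v" "y \<in> V" "m v y \<noteq> 0" shows "0 \<le> c y"
proof -
  obtain S where S: "neighbors v S" "\<And>y. y \<in> S \<Longrightarrow> 0 \<le> c y" using cubic_neighbors[OF assms(1)] by metis
  then show ?thesis using neighborsD[OF S(1) assms(2)] assms(3) by (auto split: if_splits)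
qed

text \<open>Colorings are built vertex by vertex. The separate \<open>m'\<close> for
  \<open>F\<close> remembers temporary edges that stand for paths still to be inserted;
  \<open>M\<close> is only bound by degrees in \<open>m\<close>, since for \<open>D = 1\<close>
  these make it a forest.\<close>

definition partial_coloring :: "('a \<Rightarrow> 'a \<Rightarrow> int) \<Rightarrow> 'a set \<Rightarrow> 'a set \<Rightarrow> bool" where
  "partial_coloring m' M F \<longleftrightarrow>
    M \<union> F \<subseteq> V \<and> M \<inter> F = {} \<and> (\<forall>w\<in>M. deg w M \<le> c w) \<and> forest_on m' F"

lemma partial_coloring_proper: "partial_coloring m M F \<Longrightarrow> M \<union> F \<noteq> V"
proof
  assume p: "partial_coloring m M F" and V: "M \<union> F = V"
  have "V - M = F" "finite M" using p V fin by (auto simp: partial_coloring_def)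
  moreover have "deg w M \<le> 1" if "w \<in> M" for w
  proof -
    have "deg w M \<le> c w" using p that by (simp add: partial_coloring_def)
    then show ?thesis using caps_1[of w] that V by auto
  qed
  ultimately have "coloring V m c M"
    using p V forest_on_max_degree_1[OF mult, of M]
    by (auto simp: partial_coloring_def coloring_def)
  then show False using not_colorable by blast
qed

lemma partial_coloring_F:
  assumes p: "partial_coloring m' M F" and m': "multiplicity m'"
    and v: "v \<in> V" "v \<notin> M" "v \<notin> F" "deg_in m' v F \<le> 1"
  shows "partial_coloring m' M (insert v F)"
proof -
  have "finite F" using p finite_sub by (auto simp: partial_coloring_def)
  then have "forest_on m' (insert v F)"
    using p v m' by (intro forest_on_insert) (auto simp: partial_coloring_def)
  then show ?thesis using p v by (auto simp: partial_coloring_def)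
qed

lemma partial_coloring_F_edge:
  assumes p: "partial_coloring (add_edge p q m') M F" and m': "multiplicity m'" and pq: "p \<noteq> q"
    and v: "v \<in> V" "v \<notin> M" "v \<notin> F"
    and nb: "\<And>y. y \<in> F \<Longrightarrow> m' v y \<le> of_bool (y = p) + of_bool (y = q)"
  shows "partial_coloring m' M (insert v F)"
proof -
  have "finite F" using p finite_sub by (auto simp: partial_coloring_def)
  then have "forest_on m' (insert v F)"
    by (rule forest_on_insert_edge[OF m' _ _ pq]) (use p v nb in \<open>simp_all add: partial_coloring_def\<close>)
  then show ?thesis using p v by (auto simp: partial_coloring_def)
qed

lemma partial_coloring_M:
  assumes p: "partial_coloring m' M F" and v: "v \<in> V" "v \<notin> M" "v \<notin> F" "deg v M \<le> c v"
    and w: "\<And>w. w \<in> M \<Longrightarrow> m v w \<noteq> 0 \<Longrightarrow> deg w M + m v w \<le> c w"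
  shows "partial_coloring m' (insert v M) F"
proof -
  have fM: "finite M" using p finite_sub by (auto simp: partial_coloring_def)
  have "deg u (insert v M) \<le> c u" if u: "u \<in> insert v M" for u
  proof (cases "u = v")
    case True
    then show ?thesis using v fM by simp
  next
    case False
    then have "u \<in> M" using u by simp
    then have "deg u M + m v u \<le> c u"
      using w[of u] p by (cases "m v u = 0") (auto simp: partial_coloring_def)
    then show ?thesis using fM v by (simp add: m_sym[of u v])
  qed
  then show ?thesis using p v by (auto simp: partial_coloring_def)
qed

lemma reduce_1:
  assumes V': "V' \<subset> V" and m': "multiplicity m'" "\<And>x y. m x y \<le> m' x y" and f: "\<And>v. 0 \<le> f v"
    and s: "\<And>A. A \<subseteq> V' \<Longrightarrow> A \<noteq> {} \<Longrightarrow> 2 * sum f A - 1 \<le> potential 1 m' c A"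
  obtains M F where "partial_coloring m' M F" "M \<union> F = V'" "M \<inter> F = {}"
    "\<And>v. v \<in> M \<Longrightarrow> deg v M + f v \<le> c v"
proof -
  obtain M where M: "M \<subseteq> V'" "\<And>v. v \<in> M \<Longrightarrow> deg_in m' v M + f v \<le> c v"
    "forest_on m' (V' - M)"
  proof (rule reduce[OF V' m'(1), of f])
    show "2 * sum f A - 1 \<le> potential D m' c A" if "A \<subseteq> V'" "A \<noteq> {}" for A
      using s[OF that] D_eq_1 by simp
  qed (use f in auto)
  have 1: "deg v M + f v \<le> c v" if "v \<in> M" for v
  proof -
    have "deg v M \<le> deg_in m' v M" unfolding deg_in_def by (rule sum_mono) (rule m'(2))
    then show ?thesis using M(2)[OF that] by simp
  qed
  then have "deg v M \<le> c v" if "v \<in> M" for v using f[of v] that by force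
  then have "partial_coloring m' M (V' - M)"
    using M V' by (auto simp: partial_coloring_def)
  then show ?thesis using that[of M "V' - M"] M(1) 1 by auto
qed

lemma sum_of_bool_eq: "finite A \<Longrightarrow> (\<Sum>w\<in>A. of_bool (w = a)) = (of_bool (a \<in> A) :: int)"
  by (simp add: of_bool_def)

text \<open>Delete both and reserve one unit at each of \<open>a\<close> and \<open>b\<close>; the
  gap 3 pays exactly for two units. \<open>u\<close> joins \<open>M\<close> only if its other
  neighbors are both in \<open>F\<close>, so it never needs a reserve. In either case
  \<open>v\<close> then fits into one of the classes.\<close>

lemma cubic_independent:
  assumes v: "cubic v" and u: "cubic u"
  shows "m v u = 0"
proof (rule ccontr)
  assume vu: "m v u \<noteq> 0"
  then have uv: "m u v \<noteq> 0" by (simp add: m_sym)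
  note vV = cubicD(1)[OF v] and uV = cubicD(1)[OF u] and cv = cubicD(2)[OF v] and cu = cubicD(2)[OF u]
  obtain a b where ab: "neighbors v {u, a, b}" "distinct [v, u, a, b]" "a \<in> V" "b \<in> V"
    using cubic_other_neighbors[OF v uV vu] .
  obtain a' b' where ab': "neighbors u {v, a', b'}" "distinct [u, v, a', b']" "a' \<in> V" "b' \<in> V"
    using cubic_other_neighbors[OF u vV uv] .
  obtain M F where MF: "partial_coloring m M F" "M \<union> F = V - {v, u}" "M \<inter> F = {}"
    "\<And>w. w \<in> M \<Longrightarrow> deg w M + (of_bool (w = a) + of_bool (w = b)) \<le> c w"
  proof (rule reduce_1[of "V - {v, u}" m "\<lambda>w. of_bool (w = a) + of_bool (w = b)"])
    fix A assume A: "A \<subseteq> V - {v, u}" "A \<noteq> {}"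
    then have "finite A" using finite_sub[of A] by auto
    then have "(\<Sum>w\<in>A. of_bool (w = a) + of_bool (w = b)) \<le> (2 :: int)"
      by (simp only: sum.distrib sum_of_bool_eq) simp
    moreover have "3 \<le> pot A" using gap3[of A] A vV by auto
    ultimately show "2 * (\<Sum>w\<in>A. of_bool (w = a) + of_bool (w = b)) - 1 \<le> potential 1 m c A"
      using D_eq_1 by simp
  qed (use vV mult in auto)
  have sub: "M \<subseteq> V" "F \<subseteq> V" "v \<notin> M" "v \<notin> F" "u \<notin> M" "u \<notin> F" using MF(2) by auto
  have mem: "w \<in> F \<longleftrightarrow> w \<notin> M" if "w \<in> V" "w \<noteq> u" "w \<noteq> v" for w using MF(2,3) that by blast
  have dv: "deg v X = int (card (X \<inter> {u, a, b}))" if "X \<subseteq> V" for X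
    by (rule deg_neighbors[OF ab(1) that])
  have du: "deg u X = int (card (X \<inter> {v, a', b'}))" if "X \<subseteq> V" for X
    by (rule deg_neighbors[OF ab'(1) that])
  have memF: "a \<in> F \<longleftrightarrow> a \<notin> M" "b \<in> F \<longleftrightarrow> b \<notin> M" "a' \<in> F \<longleftrightarrow> a' \<notin> M" "b' \<in> F \<longleftrightarrow> b' \<notin> M"
    using mem ab ab' by auto
  have mv: "m v w = (if w \<in> {u, a, b} then 1 else 0)" and mu: "m u w = (if w \<in> {v, a', b'} then 1 else 0)" 
    if "w \<in> V" for w using neighborsD ab(1) ab'(1) that by blast+
  show False
  proof (cases "a' \<in> F \<and> b' \<in> F")
    case True
    have 1: "partial_coloring m (insert u M) F"
    proof (rule partial_coloring_M[OF MF(1)])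
      show "deg u M \<le> c u" using True memF sub cu by (simp add: du Int_insert_right)
      show "deg w M + m u w \<le> c w" if "w \<in> M" "m u w \<noteq> 0" for w
        using that True memF sub mu[of w] by (auto split: if_splits)
    qed (use uV sub in auto)
    show False
    proof (cases "a \<in> F \<and> b \<in> F")
      case F: True
      have "partial_coloring m (insert v (insert u M)) F"
      proof (rule partial_coloring_M[OF 1])
        show "deg v (insert u M) \<le> c v"
          using F memF sub cv uV ab(2) by (simp add: dv Int_insert_right)
        show "deg w (insert u M) + m v w \<le> c w" if "w \<in> insert u M" "m v w \<noteq> 0" for w
        proof -
          have "w = u" using that F memF sub mv[of w] uV by (auto split: if_splits)
          then show ?thesis using True memF sub cu uV ab'(2) mv[OF uV]
            by (auto simp: du Int_insert_right)
        qed
      qed (use vV sub ab in auto)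
      then show False using partial_coloring_proper MF(2) vV uV by blast
    next
      case notF: False
      have "partial_coloring m (insert u M) (insert v F)"
        by (rule partial_coloring_F[OF 1 mult])
          (use notF vV sub ab(2) in \<open>auto simp: dv Int_insert_right\<close>)
      then show False using partial_coloring_proper MF(2) vV uV by blast
    qed
  next
    case False
    have 1: "partial_coloring m M (insert u F)"
      by (rule partial_coloring_F[OF MF(1) mult])
        (use False uV sub ab'(2) in \<open>auto simp: du Int_insert_right\<close>)
    show False
    proof (cases "a \<in> F \<or> b \<in> F")
      case F: True
      have "partial_coloring m (insert v M) (insert u F)"
      proof (rule partial_coloring_M[OF 1])
        show "deg v M \<le> c v" using F memF sub cv ab(2) by (auto simp: dv Int_insert_right)
        show "deg w M + m v w \<le> c w" if "w \<in> M" "m v w \<noteq> 0" for w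
          using that MF(4)[of w] sub mv[of w] by (auto simp: of_bool_def split: if_splits)
      qed (use vV sub ab in auto)
      then show False using partial_coloring_proper MF(2) vV uV by blast
    next
      case notF: False
      have "partial_coloring m M (insert v (insert u F))"
        by (rule partial_coloring_F[OF 1 mult])
          (use notF vV uV sub ab(2) in \<open>auto simp: dv Int_insert_right\<close>)
      then show False using partial_coloring_proper MF(2) vV uV by blast
    qed
  qed
qed


section \<open>Potentials of sets extended by cubic vertices\<close>

lemma pot_add_cubics:
  assumes "finite T" "A \<subseteq> V" "T \<inter> A = {}" "\<And>v. v \<in> T \<Longrightarrow> cubic v \<and> 2 \<le> deg v A"
  shows "pot (A \<union> T) \<le> pot A - int (card T)"
  using assms
proof (induction T)
  case (insert v T)
  have v: "cubic v" "2 \<le> deg v A" "v \<notin> A \<union> T" using insert by auto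
  have fA: "finite A" using insert(4) by (rule finite_sub)
  have "pot (insert v (A \<union> T)) = pot (A \<union> T) + 7 - 4 * deg v (A \<union> T)"
    using pot_insert_1[of "A \<union> T" v] v insert(1) fA cubicD[OF v(1)] by simp
  moreover have "2 \<le> deg v (A \<union> T)"
    using deg_in_mono[OF mult, of "A \<union> T" A v] v fA insert(1) by simp
  moreover have "pot (A \<union> T) \<le> pot A - int (card T)" using insert by auto
  ultimately show ?case using insert by simp
qed simp

text \<open>Each cubic vertex changes the potential by at most \<open>7 - 4 * 2 = -1\<close>, its
  edge to \<open>u\<close> by another \<open>-4\<close>, and \<open>u\<close> itself brings
  7.\<close>

lemma pot_add_star:
  assumes A: "A \<subseteq> V" and T: "finite T" "T \<inter> A = {}" "\<And>v. v \<in> T \<Longrightarrow> cubic v \<and> 2 \<le> deg v A"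
    and u: "u \<notin> A" "u \<notin> T" "c u = 1" "\<And>v. v \<in> T \<Longrightarrow> m u v = 1"
  shows "pot (insert u (A \<union> T)) \<le> pot A + 7 - 5 * int (card T) - 4 * deg u A"
proof -
  have fA: "finite A" using A by (rule finite_sub)
  have "deg u T = (\<Sum>v\<in>T. 1)" unfolding deg_in_def using u(4) by (intro sum.cong) auto
  then have "deg u (A \<union> T) = deg u A + int (card T)"
    using deg_in_Un[OF fA T(1), of m u] T(2) by auto
  then show ?thesis
    using pot_insert_1[of "A \<union> T" u] fA T(1) u pot_add_cubics[OF T(1) A T(2,3)] by simp
qed

text \<open>The vertex \<open>z\<close> left out makes the extended set proper, so
  \<open>gap4\<close> applies to it. Read backwards, this bounds \<open>pot A\<close> from below,
  which is what pays for temporary edges inside \<open>A\<close>.\<close>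

lemma pot_ge_star:
  assumes A: "A \<subseteq> V" "A \<noteq> {}" and T: "finite T" "T \<inter> A = {}"
    "\<And>v. v \<in> T \<Longrightarrow> cubic v \<and> 2 \<le> deg v A"
    and u: "u \<notin> A" "u \<notin> T" "u \<in> V" "c u = 1" "\<And>v. v \<in> T \<Longrightarrow> m u v = 1"
    and z: "z \<in> V" "z \<noteq> u" "z \<notin> A" "z \<notin> T"
  shows "5 * int (card T) + 4 * deg u A - 3 \<le> pot A"
proof -
  have fA: "finite A" using A(1) by (rule finite_sub)
  have "4 \<le> pot (insert u (A \<union> T))"
  proof (rule gap4)
    show "insert u (A \<union> T) \<subset> V" using A T u z cubicD(1) by blast
    have "card (insert u A) \<le> card (insert u (A \<union> T))" using fA T(1) by (intro card_mono) auto
    moreover have "0 < card A" using A(2) fA by (simp add: card_gt_0_iff)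
    ultimately show "2 \<le> card (insert u (A \<union> T))" using card_insert_disjoint[OF fA u(1)] by linarith
  qed
  then show ?thesis using pot_add_star[OF A(1) T u(1,2,4,5)] by linarith
qed

lemma pot_ge_cubic:
  assumes A: "A \<subseteq> V" "A \<noteq> {}" and v: "cubic v" "2 \<le> deg v A" "v \<notin> A"
    and z: "z \<in> V" "z \<noteq> v" "z \<notin> A"
  shows "5 \<le> pot A"
proof -
  have fA: "finite A" using A(1) by (rule finite_sub)
  have "4 \<le> pot (insert v A)"
  proof (rule gap4)
    show "insert v A \<subset> V" using A v z cubicD(1) by blast
    have "0 < card A" using A(2) fA by (simp add: card_gt_0_iff)
    then show "2 \<le> card (insert v A)" using card_insert_disjoint[OF fA v(3)] by linarith
  qed
  then show ?thesis using pot_add_cubics[of "{v}" A] A v by simp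
qed

lemma deg_ge_2:
  assumes S: "neighbors v S" "finite S" "p \<in> S" "q \<in> S" "p \<noteq> q" and A: "A \<subseteq> V" "p \<in> A" "q \<in> A"
  shows "2 \<le> deg v A"
proof -
  have "card {p, q} \<le> card (A \<inter> S)" using assms by (intro card_mono) auto
  then show ?thesis using deg_neighbors[OF S(1) A(1)] S(5) by simp
qed

lemma add_edge_ge: "m' x y \<le> add_edge p q m' x y"
  by (simp add: add_edge_def)

lemma add_edge_other: "v \<noteq> p \<Longrightarrow> v \<noteq> q \<Longrightarrow> add_edge p q m' v y = m' v y"
  by (simp add: add_edge_def)

text \<open>
  Delete \<open>u\<close> and its neighbors, and join the two outer neighbors of each of \<open>v1\<close>, \<open>v2\<close>, \<open>v3\<close> by an
  edge: then \<open>u\<close> can be put into \<open>M\<close> and \<open>v1\<close>, \<open>v2\<close>, \<open>v3\<close> into \<open>F\<close>, whatever the colors outside.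
\<close>

lemma not_four_cubic_neighbors:
  assumes u: "u \<in> V" "c u = 1" and nu: "neighbors u {v1, v2, v3, v4}" "distinct [v1, v2, v3, v4]"
    and cu: "cubic v1" "cubic v2" "cubic v3" "cubic v4"
  shows False
proof -
  have uv: "m v u \<noteq> 0" if "v \<in> {v1, v2, v3, v4}" for v
  proof -
    have "v \<in> V" using that neighbors_sub[OF nu(1)] by blast
    then show ?thesis using neighborsD[OF nu(1)] that by (simp add: m_sym[of v u])
  qed
  obtain p1 q1 where n1: "neighbors v1 {u, p1, q1}" "distinct [v1, u, p1, q1]" "p1 \<in> V" "q1 \<in> V"
    using cubic_other_neighbors[OF cu(1) u(1)] uv by blast
  obtain p2 q2 where n2: "neighbors v2 {u, p2, q2}" "distinct [v2, u, p2, q2]" "p2 \<in> V" "q2 \<in> V"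
    using cubic_other_neighbors[OF cu(2) u(1)] uv by blast
  obtain p3 q3 where n3: "neighbors v3 {u, p3, q3}" "distinct [v3, u, p3, q3]" "p3 \<in> V" "q3 \<in> V"
    using cubic_other_neighbors[OF cu(3) u(1)] uv by blast
  obtain p4 q4 where n4: "neighbors v4 {u, p4, q4}" "distinct [v4, u, p4, q4]" "p4 \<in> V" "q4 \<in> V"
    using cubic_other_neighbors[OF cu(4) u(1)] uv by blast
  define S where "S = {v1, v2, v3, v4}"
  have cS: "cubic v" if "v \<in> S" for v using that cu by (auto simp: S_def)
  have SV: "S \<subseteq> V" "u \<notin> S"
    using neighbors_sub[OF nu(1)] neighbors_irrefl[OF nu(1)] by (auto simp: S_def)
  have indep: "y \<notin> S" if "neighbors v N" "v \<in> S" "y \<in> N" for v N y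
  proof
    assume "y \<in> S"
    then have "m v y = 0" using cubic_independent cS that by blast
    moreover have "m v y = 1" using neighborsD[OF that(1)] neighbors_sub[OF that(1)] that(3) by auto
    ultimately show False by simp
  qed
  have out: "{p1, q1, p2, q2, p3, q3, p4, q4} \<inter> S = {}"
    using indep[OF n1(1)] indep[OF n2(1)] indep[OF n3(1)] indep[OF n4(1)] by (simp add: S_def)
  let ?m3 = "add_edge p3 q3 m" let ?m2 = "add_edge p2 q2 ?m3" let ?m1 = "add_edge p1 q1 ?m2"
  have mult3: "multiplicity ?m3" "multiplicity ?m2" "multiplicity ?m1"
    using mult n1(2) n2(2) n3(2) by (auto intro!: multiplicity_add_edge)
  obtain M F where MF: "partial_coloring ?m1 M F" "M \<union> F = V - insert u S" "M \<inter> F = {}"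
    "\<And>w. w \<in> M \<Longrightarrow> deg w M + 0 \<le> c w"
  proof (rule reduce_1[of "V - insert u S" ?m1 "\<lambda>_. 0"])
    fix A assume A: "A \<subseteq> V - insert u S" "A \<noteq> {}"
    have AV: "A \<subseteq> V" "u \<notin> A" "S \<inter> A = {}" and fA: "finite A" using A finite_sub[of A] by auto
    define e1 e2 e3 where "e1 = (p1 \<in> A \<and> q1 \<in> A)" and "e2 = (p2 \<in> A \<and> q2 \<in> A)"
      and "e3 = (p3 \<in> A \<and> q3 \<in> A)"
    have d: "e1 \<Longrightarrow> 2 \<le> deg v1 A" "e2 \<Longrightarrow> 2 \<le> deg v2 A" "e3 \<Longrightarrow> 2 \<le> deg v3 A"
      using deg_ge_2[OF n1(1) _ _ _ _ AV(1), of p1 q1] deg_ge_2[OF n2(1) _ _ _ _ AV(1), of p2 q2]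
        deg_ge_2[OF n3(1) _ _ _ _ AV(1), of p3 q3] n1(2) n2(2) n3(2)
      by (auto simp: e1_def e2_def e3_def)
    \<comment> \<open>Inside \<open>A\<close>, \<open>k\<close> temporary edges cost
      \<open>4 * k\<close>. For \<open>k >= 2\<close> the star around \<open>u\<close> provides
      \<open>5 * k - 3\<close>, with \<open>v4\<close> as the vertex left out; for
      \<open>k = 1\<close> the gap 3 is enough.\<close>
    have star: "5 * int (card T) - 3 \<le> pot A"
      if "T \<subseteq> {v1, v2, v3}" "\<And>v. v \<in> T \<Longrightarrow> 2 \<le> deg v A" for T
    proof -
      have "5 * int (card T) + 4 * deg u A - 3 \<le> pot A"
      proof (rule pot_ge_star[OF AV(1) A(2), of T u v4])
        show "finite T" using that(1) by (rule finite_subset) simp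
        show "m u v = 1" if "v \<in> T" for v
          using neighborsD[OF nu(1), of v] \<open>T \<subseteq> {v1, v2, v3}\<close> SV that by (auto simp: S_def)
      qed (use AV SV u nu(2) cu that in \<open>auto simp: S_def\<close>)
      then show ?thesis using deg_nonneg[of u A] by linarith
    qed
    have h0: "3 \<le> pot A" using gap3[of A] A u by auto
    have h: "e1 \<Longrightarrow> e2 \<Longrightarrow> 7 \<le> pot A" "e1 \<Longrightarrow> e3 \<Longrightarrow> 7 \<le> pot A" "e2 \<Longrightarrow> e3 \<Longrightarrow> 7 \<le> pot A"
      "e1 \<Longrightarrow> e2 \<Longrightarrow> e3 \<Longrightarrow> 12 \<le> pot A"
      using star[of "{v1, v2}"] star[of "{v1, v3}"] star[of "{v2, v3}"] star[of "{v1, v2, v3}"] d nu(2)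
      by auto
    have "potential 1 ?m1 c A = pot A - 4 * of_bool e1 - 4 * of_bool e2 - 4 * of_bool e3"
      using n1(2) n2(2) n3(2) D_eq_1 by (simp add: potential_add_edge[OF fA] e1_def e2_def e3_def)
    then show "2 * (\<Sum>w\<in>A. 0) - 1 \<le> potential 1 ?m1 c A"
      using h0 h by (cases e1; cases e2; cases e3) auto
  next
    show "m x y \<le> ?m1 x y" for x y by (simp add: add_edge_def)
  qed (use u mult3 in auto)
  have sub: "M \<subseteq> V" "F \<subseteq> V" "u \<notin> M" "u \<notin> F" "S \<inter> M = {}" "S \<inter> F = {}" using MF(2) by auto
  have vs: "v1 \<notin> M" "v2 \<notin> M" "v3 \<notin> M" "v4 \<notin> M" "v1 \<notin> F" "v2 \<notin> F" "v3 \<notin> F" "v4 \<notin> F"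
    "v1 \<in> V" "v2 \<in> V" "v3 \<in> V" "v4 \<in> V" using sub SV by (auto simp: S_def)
  have dist: "v1 \<noteq> v2" "v1 \<noteq> v3" "v1 \<noteq> v4" "v2 \<noteq> v3" "v2 \<noteq> v4" "v3 \<noteq> v4" using nu(2) by auto
  have vp: "v1 \<notin> {p2, q2, p3, q3}" "v2 \<notin> {p3, q3}" using out by (auto simp: S_def)
  have "partial_coloring ?m2 M (insert v1 F)"
  proof (rule partial_coloring_F_edge[OF MF(1) mult3(2)])
    fix y assume "y \<in> F"
    then have "y \<in> V" "y \<noteq> u" using sub by auto
    then show "?m2 v1 y \<le> of_bool (y = p1) + of_bool (y = q1)"
      using vp neighborsD[OF n1(1), of y] by (auto simp: add_edge_other)
  qed (use n1(2) vs in auto)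
  then have "partial_coloring ?m3 M (insert v2 (insert v1 F))"
  proof (rule partial_coloring_F_edge[OF _ mult3(1)])
    fix y assume "y \<in> insert v1 F"
    then have "y \<in> V" "y \<noteq> u" using sub vs SV by (auto simp: S_def)
    then show "?m3 v2 y \<le> of_bool (y = p2) + of_bool (y = q2)"
      using vp neighborsD[OF n2(1), of y] by (auto simp: add_edge_other)
  qed (use n2(2) vs dist in auto)
  then have 3: "partial_coloring m M (insert v3 (insert v2 (insert v1 F)))"
  proof (rule partial_coloring_F_edge[OF _ mult])
    fix y assume "y \<in> insert v2 (insert v1 F)"
    then have "y \<in> V" "y \<noteq> u" using sub vs SV by (auto simp: S_def)
    then show "m v3 y \<le> of_bool (y = p3) + of_bool (y = q3)"
      using neighborsD[OF n3(1), of y] by auto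
  qed (use n3(2) vs dist in auto)
  let ?F = "insert v3 (insert v2 (insert v1 F))"
  have 4: "partial_coloring m (insert u M) ?F"
  proof (rule partial_coloring_M[OF 3])
    show "deg u M \<le> c u" using vs sub u by (simp add: deg_neighbors[OF nu(1)] Int_insert_right)
    show "deg w M + m u w \<le> c w" if "w \<in> M" "m u w \<noteq> 0" for w
      using that neighborsD[OF nu(1), of w] sub vs by (auto split: if_splits)
  qed (use u sub SV in \<open>auto simp: S_def\<close>)
  have FV: "?F \<subseteq> V" using sub vs by auto
  have mem: "p4 \<in> F \<longleftrightarrow> p4 \<notin> M" "q4 \<in> F \<longleftrightarrow> q4 \<notin> M"
    using MF(2,3) n4 out by auto
  \<comment> \<open>If both outer neighbors of \<open>v4\<close> are in \<open>F\<close>, it joins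
    \<open>M\<close> and its only neighbor there is \<open>u\<close>, which has no other. Otherwise
    it joins \<open>F\<close>, next to at most one neighbor.\<close>
  show False
  proof (cases "p4 \<in> F \<and> q4 \<in> F")
    case True
    have "partial_coloring m (insert v4 (insert u M)) ?F"
    proof (rule partial_coloring_M[OF 4])
      show "deg v4 (insert u M) \<le> c v4"
        using True mem n4(2) sub u cubicD[OF cu(4)] 
        by (auto simp: deg_neighbors[OF n4(1)] Int_insert_right)
      show "deg w (insert u M) + m v4 w \<le> c w" if "w \<in> insert u M" "m v4 w \<noteq> 0" for w
      proof -
        have "w = u"
          using that neighborsD[OF n4(1), of w] sub mem True by (auto split: if_splits)
        moreover have "deg u (insert u M) = 0"
          using vs sub u SV by (auto simp: deg_neighbors[OF nu(1)] Int_insert_right S_def)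
        ultimately show ?thesis using neighborsD[OF n4(1) u(1)] u by simp
      qed
    qed (use vs dist SV in \<open>auto simp: S_def\<close>)
    then show False using partial_coloring_proper MF(2) u vs by (auto simp: S_def)
  next
    case False
    have "partial_coloring m (insert u M) (insert v4 ?F)"
    proof (rule partial_coloring_F[OF 4 mult])
      have "u \<notin> ?F" "v4 \<notin> insert u M" "v4 \<notin> ?F" using sub SV vs dist by (auto simp: S_def)
      moreover have "p4 \<notin> S" "q4 \<notin> S" using out by auto
      then have "p4 \<in> ?F \<longleftrightarrow> p4 \<in> F" "q4 \<in> ?F \<longleftrightarrow> q4 \<in> F" by (auto simp: S_def)
      ultimately show "v4 \<notin> insert u M" "v4 \<notin> ?F" "deg v4 ?F \<le> 1"
        using False n4(2) deg_neighbors[OF n4(1) FV] by (auto simp: Int_insert_right)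
    qed (use vs in auto)
    then show False using partial_coloring_proper MF(2) u vs by (auto simp: S_def)
  qed
qed


lemma cubic_not_neighbor:
  assumes "cubic v" "cubic y" "neighbors v N" shows "y \<notin> N"
proof
  assume y: "y \<in> N"
  then have "m v y = 1" using neighborsD[OF assms(3)] neighbors_sub[OF assms(3)] by auto
  then show False using cubic_independent[OF assms(1,2)] by simp
qed

lemma partial_coloring_add_edge:
  assumes p: "partial_coloring (add_edge p q m') M F"
  shows "partial_coloring m' M F"
proof -
  have le: "deg_sum m' Y \<le> deg_sum (add_edge p q m') Y" for Y
    unfolding deg_sum_def cross_def deg_in_def by (intro sum_mono add_edge_ge)
  show ?thesis
    using p order_trans[OF le] by (simp add: partial_coloring_def forest_on_def)
qed

text \<open>
  As before, edges between the outer neighbors of \<open>v1\<close> and of \<open>v2\<close> let these join \<open>F\<close>; the capacity of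
  \<open>s\<close> is lowered so that \<open>r\<close> can always join \<open>M\<close>.
\<close>

lemma no_cubic_triangle:
  assumes r: "r \<in> V" "c r = 1" and nr: "neighbors r {v, v1, v2, s}" "distinct [v, v1, v2, s]"
    and cu: "cubic v" "cubic v1" "cubic v2" and vs: "m v s \<noteq> 0"
  shows False
proof -
  have rv: "m w r \<noteq> 0" if "w \<in> {v, v1, v2, s}" for w
  proof -
    have "w \<in> V" using that neighbors_sub[OF nr(1)] by blast
    then show ?thesis using neighborsD[OF nr(1)] that by (simp add: m_sym[of w r])
  qed
  have inV: "v \<in> V" "v1 \<in> V" "v2 \<in> V" "s \<in> V" using neighbors_sub[OF nr(1)] by auto
  have rn: "r \<noteq> v" "r \<noteq> v1" "r \<noteq> v2" "r \<noteq> s" using neighbors_irrefl[OF nr(1)] by auto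
  obtain p1 q1 where n1: "neighbors v1 {r, p1, q1}" "distinct [v1, r, p1, q1]" "p1 \<in> V" "q1 \<in> V"
    using cubic_other_neighbors[OF cu(2) r(1)] rv by blast
  obtain p2 q2 where n2: "neighbors v2 {r, p2, q2}" "distinct [v2, r, p2, q2]" "p2 \<in> V" "q2 \<in> V"
    using cubic_other_neighbors[OF cu(3) r(1)] rv by blast
  obtain p q where pq: "neighbors v {r, p, q}" "distinct [v, r, p, q]" "p \<in> V" "q \<in> V"
    using cubic_other_neighbors[OF cu(1) r(1)] rv by blast
  have "s = p \<or> s = q" using neighborsD[OF pq(1) inV(4)] vs rn by (auto split: if_splits)
  then obtain x where n: "neighbors v {r, s, x}" "distinct [v, r, s, x]" "x \<in> V"
  proof
    assume "s = p"
    then show thesis using pq by (intro that[of q]) auto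
  next
    assume "s = q"
    then show thesis using pq by (intro that[of p]) (auto simp: insert_commute)
  qed
  define S where "S = {v, v1, v2}"
  have cS: "cubic w" if "w \<in> S" for w using that cu by (auto simp: S_def)
  have SV: "S \<subseteq> V" "r \<notin> S" "s \<notin> S" using inV rn nr(2) by (auto simp: S_def)
  have out: "{p1, q1, p2, q2, x, s} \<inter> S = {}"
    using cubic_not_neighbor[OF cu(2) cS n1(1)] cubic_not_neighbor[OF cu(3) cS n2(1)]
      cubic_not_neighbor[OF cu(1) cS n(1)] by auto
  let ?m2 = "add_edge p2 q2 m" let ?m1 = "add_edge p1 q1 ?m2"
  have mult2: "multiplicity ?m2" "multiplicity ?m1"
    using mult n1(2) n2(2) by (auto intro!: multiplicity_add_edge)
  obtain M F where MF: "partial_coloring ?m1 M F" "M \<union> F = V - insert r S" "M \<inter> F = {}"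
    "\<And>w. w \<in> M \<Longrightarrow> deg w M + of_bool (w = s) \<le> c w"
  proof (rule reduce_1[of "V - insert r S" ?m1 "\<lambda>w. of_bool (w = s)"])
    fix A assume A: "A \<subseteq> V - insert r S" "A \<noteq> {}"
    have AV: "A \<subseteq> V" "r \<notin> A" "S \<inter> A = {}" and fA: "finite A" using A finite_sub[of A] by auto
    have nA: "v \<notin> A" "v1 \<notin> A" "v2 \<notin> A" using AV by (auto simp: S_def)
    define e1 e2 es where "e1 = (p1 \<in> A \<and> q1 \<in> A)" and "e2 = (p2 \<in> A \<and> q2 \<in> A)"
      and "es = (s \<in> A)"
    have d: "e1 \<Longrightarrow> 2 \<le> deg v1 A" "e2 \<Longrightarrow> 2 \<le> deg v2 A"
      using deg_ge_2[OF n1(1) _ _ _ _ AV(1), of p1 q1] deg_ge_2[OF n2(1) _ _ _ _ AV(1), of p2 q2]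
        n1(2) n2(2) by (auto simp: e1_def e2_def)
    have h0: "3 \<le> pot A" using gap3[of A] A r by auto
    \<comment> \<open>One temporary edge together with the reserve at \<open>s\<close> needs
      potential \<open>4 + 2 - 1 = 5\<close>. Two edges with the reserve need 9, and then the edge
      \<open>rs\<close> itself raises the star bound to 11.\<close>
    have h1: "e1 \<Longrightarrow> 5 \<le> pot A" "e2 \<Longrightarrow> 5 \<le> pot A"
      using pot_ge_cubic[OF AV(1) A(2) cu(2) _ nA(2) r(1)] pot_ge_cubic[OF AV(1) A(2) cu(3) _ nA(3) r(1)]
        d rn AV(2) by auto
    have dr: "deg r A = of_bool es"
      using nA by (simp add: deg_neighbors[OF nr(1) AV(1)] Int_insert_right es_def)
    have h2: "7 + 4 * of_bool es \<le> pot A" if e: "e1" "e2"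
    proof -
      have "5 * int (card {v1, v2}) + 4 * deg r A - 3 \<le> pot A"
      proof (rule pot_ge_star[OF AV(1) A(2), of "{v1, v2}" r v])
        show "m r w = 1" if "w \<in> {v1, v2}" for w
          using neighborsD[OF nr(1), of w] inV that by auto
      qed (use AV nA inV r rn cu nr(2) d e in auto)
      then show ?thesis using nr(2) dr by simp
    qed
    have "potential 1 ?m1 c A = pot A - 4 * of_bool e1 - 4 * of_bool e2"
      using n1(2) n2(2) D_eq_1 by (simp add: potential_add_edge[OF fA] e1_def e2_def)
    moreover have "(\<Sum>w\<in>A. of_bool (w = s)) = (of_bool es :: int)"
      unfolding es_def by (rule sum_of_bool_eq[OF fA])
    ultimately show "2 * (\<Sum>w\<in>A. of_bool (w = s)) - 1 \<le> potential 1 ?m1 c A"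
      using h0 h1 h2 by (cases e1; cases e2; cases es) auto
  next
    show "m x y \<le> ?m1 x y" for x y by (simp add: add_edge_def)
  qed (use r mult2 in auto)
  have sub: "M \<subseteq> V" "F \<subseteq> V" "r \<notin> M" "r \<notin> F" "S \<inter> M = {}" "S \<inter> F = {}" using MF(2) by auto
  have vs: "v1 \<notin> M" "v2 \<notin> M" "v \<notin> M" "v1 \<notin> F" "v2 \<notin> F" "v \<notin> F"
    using sub SV by (auto simp: S_def)
  have dist: "v1 \<noteq> v2" "v1 \<noteq> v" "v2 \<noteq> v" using nr(2) by auto
  have vp: "v1 \<notin> {p2, q2}" using out by (auto simp: S_def)
  have "partial_coloring ?m2 M (insert v1 F)"
  proof (rule partial_coloring_F_edge[OF MF(1) mult2(1)])
    fix y assume "y \<in> F"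
    then have "y \<in> V" "y \<noteq> r" using sub by auto
    then show "?m2 v1 y \<le> of_bool (y = p1) + of_bool (y = q1)"
      using vp neighborsD[OF n1(1), of y] by (auto simp: add_edge_other)
  qed (use n1(2) vs inV in auto)
  then have 2: "partial_coloring m M (insert v2 (insert v1 F))"
  proof (rule partial_coloring_F_edge[OF _ mult])
    fix y assume "y \<in> insert v1 F"
    then have "y \<in> V" "y \<noteq> r" using sub inV rn by auto
    then show "m v2 y \<le> of_bool (y = p2) + of_bool (y = q2)"
      using neighborsD[OF n2(1), of y] by auto
  qed (use n2(2) vs dist inV in auto)
  let ?F = "insert v2 (insert v1 F)"
  have 4: "partial_coloring m (insert r M) ?F"
  proof (rule partial_coloring_M[OF 2])
    show "deg r M \<le> c r" using vs sub r by (simp add: deg_neighbors[OF nr(1)] Int_insert_right)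
    show "deg w M + m r w \<le> c w" if "w \<in> M" "m r w \<noteq> 0" for w
      using that neighborsD[OF nr(1), of w] sub vs MF(4)[of w]
      by (auto simp: of_bool_def split: if_splits)
  qed (use r sub rn in auto)
  have FV: "?F \<subseteq> V" using sub inV by auto
  have mem: "s \<in> F \<longleftrightarrow> s \<notin> M" "x \<in> F \<longleftrightarrow> x \<notin> M"
    using MF(2,3) n inV rn out by auto
  \<comment> \<open>The triangle matters here: if \<open>s\<close> is in \<open>M\<close>, it may
    take up the capacity of \<open>r\<close>, but as a neighbor of \<open>v\<close> it then also
    lets \<open>v\<close> join \<open>F\<close>. If \<open>s\<close> and \<open>x\<close> are both
    in \<open>F\<close>, the capacity of \<open>r\<close> is free for \<open>v\<close>.\<close>
  show False
  proof (cases "s \<in> F \<and> x \<in> F")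
    case True
    have "partial_coloring m (insert v (insert r M)) ?F"
    proof (rule partial_coloring_M[OF 4])
      show "deg v (insert r M) \<le> c v"
        using True mem n(2) sub r cubicD[OF cu(1)] 
        by (auto simp: deg_neighbors[OF n(1)] Int_insert_right)
      show "deg w (insert r M) + m v w \<le> c w" if "w \<in> insert r M" "m v w \<noteq> 0" for w
      proof -
        have "w = r"
          using that neighborsD[OF n(1), of w] sub mem True by (auto split: if_splits)
        moreover have "deg r (insert r M) = 0"
          using vs sub r rn mem True by (auto simp: deg_neighbors[OF nr(1)] Int_insert_right)
        ultimately show ?thesis using neighborsD[OF n(1) r(1)] r by simp
      qed
    qed (use vs dist inV rn in auto)
    then show False using partial_coloring_proper MF(2) r inV by (auto simp: S_def)
  next
    case False
    have "partial_coloring m (insert r M) (insert v ?F)"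
    proof (rule partial_coloring_F[OF 4 mult])
      have "r \<notin> ?F" "v \<notin> insert r M" "v \<notin> ?F" using sub rn vs dist by auto
      moreover have "x \<notin> S" using out by auto
      then have "s \<in> ?F \<longleftrightarrow> s \<in> F" "x \<in> ?F \<longleftrightarrow> x \<in> F" using SV by (auto simp: S_def)
      ultimately show "v \<notin> insert r M" "v \<notin> ?F" "deg v ?F \<le> 1"
        using False n(2) deg_neighbors[OF n(1) FV] by (auto simp: Int_insert_right)
    qed (use inV in auto)
    then show False using partial_coloring_proper MF(2) r inV by (auto simp: S_def)
  qed
qed

text \<open>
  After deleting \<open>x\<close>, \<open>u\<close> and \<open>v\<close>, an edge joins the outer neighbors of \<open>v\<close> and the capacities of those
  of \<open>u\<close> are lowered. The vertex \<open>x\<close> gets the color that \<open>y\<close> does not have.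
\<close>

lemma no_double_edge:
  assumes x: "x \<in> V" "c x = 1" and y: "y \<in> V" "m x y = 2"
    and v: "cubic v" "cubic u" "v \<noteq> u" "m x v = 1" "m x u = 1"
    and dx: "deg x V = 4"
  shows False
proof -
  have vV: "v \<in> V" "u \<in> V" using v cubicD by auto
  have xn: "x \<noteq> v" "x \<noteq> u" "x \<noteq> y" "y \<noteq> v" "y \<noteq> u" using v(4,5) y(2) by auto
  have dxA: "deg x A = of_bool (v \<in> A) + of_bool (u \<in> A) + 2 * of_bool (y \<in> A)"
    if A: "A \<subseteq> V" for A
  proof -
    have fA: "finite A" using A by (rule finite_sub)
    have "deg x {v, u, y} = 4" using v y xn by (simp add: deg_in_def)
    then have "deg x (V - {v, u, y}) = 0" using deg_in_split[OF fin, of "{v, u, y}" m x] dx vV y by simp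
    then have 0: "m x w = 0" if "w \<in> V - {v, u, y}" for w
      using deg_in_eq_0_iff[OF mult, of "V - {v, u, y}" x] fin that by blast
    have "deg x A = (\<Sum>w\<in>A. of_bool (w = v) + of_bool (w = u) + 2 * of_bool (w = y))"
      unfolding deg_in_def
    proof (rule sum.cong[OF refl])
      fix w assume "w \<in> A"
      then show "m x w = of_bool (w = v) + of_bool (w = u) + 2 * of_bool (w = y)"
        using 0[of w] A v y xn by (cases "w \<in> {v, u, y}") auto
    qed
    then show ?thesis
      by (simp only: sum.distrib sum_of_bool_eq[OF fA] flip: sum_distrib_left)
  qed
  have xv: "m v x \<noteq> 0" "m u x \<noteq> 0" using v(4,5) by (simp_all add: m_sym[of _ x])
  obtain p q where n: "neighbors v {x, p, q}" "distinct [v, x, p, q]" "p \<in> V" "q \<in> V"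
    using cubic_other_neighbors[OF v(1) x(1) xv(1)] .
  obtain p' q' where n': "neighbors u {x, p', q'}" "distinct [u, x, p', q']" "p' \<in> V" "q' \<in> V"
    using cubic_other_neighbors[OF v(2) x(1) xv(2)] .
  define S where "S = {v, u}"
  have cS: "cubic w" if "w \<in> S" for w using that v by (auto simp: S_def)
  have out: "{p, q, p', q'} \<inter> S = {}"
    using cubic_not_neighbor[OF v(1) cS n(1)] cubic_not_neighbor[OF v(2) cS n'(1)] by auto
  let ?f = "\<lambda>w. of_bool (w = p') + of_bool (w = q') :: int"
  let ?m1 = "add_edge p q m"
  have mult1: "multiplicity ?m1" using mult n(2) by (auto intro!: multiplicity_add_edge)
  obtain M F where MF: "partial_coloring ?m1 M F" "M \<union> F = V - insert x S" "M \<inter> F = {}"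
    "\<And>w. w \<in> M \<Longrightarrow> deg w M + ?f w \<le> c w"
  proof (rule reduce_1[of "V - insert x S" ?m1 ?f])
    fix A assume A: "A \<subseteq> V - insert x S" "A \<noteq> {}"
    have AV: "A \<subseteq> V" "x \<notin> A" "S \<inter> A = {}" and fA: "finite A" using A finite_sub[of A] by auto
    have nA: "v \<notin> A" "u \<notin> A" using AV by (auto simp: S_def)
    define e f g where "e = (p \<in> A \<and> q \<in> A)" and "f = (p' \<in> A)" and "g = (q' \<in> A)"
    have d: "e \<Longrightarrow> 2 \<le> deg v A" "f \<Longrightarrow> g \<Longrightarrow> 2 \<le> deg u A"
      using deg_ge_2[OF n(1) _ _ _ _ AV(1), of p q] deg_ge_2[OF n'(1) _ _ _ _ AV(1), of p' q']
        n(2) n'(2) by (auto simp: e_def f_def g_def)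
    have h0: "3 \<le> pot A" using gap3[of A] A x by auto
    have h1: "e \<Longrightarrow> 5 \<le> pot A"
      using pot_ge_cubic[OF AV(1) A(2) v(1) _ nA(1) x(1)] d xn AV(2) by auto
    \<comment> \<open>The temporary edge and two reserves need \<open>4 + 2 * 2 - 1 = 7\<close>. If
      \<open>y\<close> is in \<open>A\<close>, no vertex need be left out of the extended set, but
      the double edge makes up for this even with \<open>sparse\<close> in place of
      \<open>gap4\<close>.\<close>
    have h2: "7 \<le> pot A" if e: "e" "f" "g"
    proof -
      have mx: "m x w = 1" if "w \<in> {v, u}" for w using that v by auto
      show ?thesis
      proof (cases "y \<in> A")
        case True
        then have "deg x A = 2" using dxA[OF AV(1)] nA by simp
        moreover have "pot (insert x (A \<union> {v, u})) \<le> pot A + 7 - 5 * int (card {v, u}) - 4 * deg x A"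
          by (rule pot_add_star[OF AV(1) _ _ _ AV(2) _ x(2) mx]) (use nA xn d e v in auto)
        moreover have "- 1 \<le> pot (insert x (A \<union> {v, u}))"
          using AV x vV by (intro sparse) auto
        ultimately show ?thesis using v(3) by simp
      next
        case False
        have "5 * int (card {v, u}) + 4 * deg x A - 3 \<le> pot A"
          by (rule pot_ge_star[OF AV(1) A(2) _ _ _ AV(2) _ x mx y(1)])
            (use nA xn d e v False in auto)
        then show ?thesis using v(3) deg_nonneg[of x A] by simp
      qed
    qed
    have "potential 1 ?m1 c A = pot A - 4 * of_bool e"
      using n(2) D_eq_1 by (simp add: potential_add_edge[OF fA] e_def)
    moreover have "sum ?f A = of_bool f + of_bool g"
      by (simp only: sum.distrib sum_of_bool_eq[OF fA] f_def g_def)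
    ultimately show "2 * sum ?f A - 1 \<le> potential 1 ?m1 c A"
      using h0 h1 h2 by (cases e; cases f; cases g) auto
  next
    show "m x y \<le> ?m1 x y" for x y by (simp add: add_edge_def)
  qed (use x mult1 in auto)
  have sub: "M \<subseteq> V" "F \<subseteq> V" "x \<notin> M" "x \<notin> F" "v \<notin> M" "v \<notin> F" "u \<notin> M" "u \<notin> F"
    using MF(2) by (auto simp: S_def)
  have pn: "p \<notin> {v, u, x}" "q \<notin> {v, u, x}" "p' \<notin> {v, u, x}" "q' \<notin> {v, u, x}"
    using out n(2) n'(2) by (auto simp: S_def)
  have mem: "p \<in> F \<longleftrightarrow> p \<notin> M" "q \<in> F \<longleftrightarrow> q \<notin> M" "p' \<in> F \<longleftrightarrow> p' \<notin> M" "q' \<in> F \<longleftrightarrow> q' \<notin> M"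
    "y \<in> F \<longleftrightarrow> y \<notin> M"
    using MF(2,3) n(3,4) n'(3,4) pn y(1) xn by (auto simp: S_def)
  have dv: "deg v X = int (card (X \<inter> {x, p, q}))" and du: "deg u X = int (card (X \<inter> {x, p', q'}))"
    if "X \<subseteq> V" for X by (rule deg_neighbors[OF n(1) that], rule deg_neighbors[OF n'(1) that])
  have mv: "m v w = (if w \<in> {x, p, q} then 1 else 0)" and mu: "m u w = (if w \<in> {x, p', q'} then 1 else 0)"
    if "w \<in> V" for w using neighborsD[OF n(1) that] neighborsD[OF n'(1) that] by auto
  have mx: "m x w = 0" if "w \<in> V" "w \<notin> {v, u, y}" for w
    using dxA[of "{w}"] that by (auto simp: deg_in_def)
  show False
  proof (cases "y \<in> M")
    case False
    have "partial_coloring m M (insert v F)"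
    proof (rule partial_coloring_F_edge[OF MF(1) mult])
      show "m v w \<le> of_bool (w = p) + of_bool (w = q)" if "w \<in> F" for w
        using mv[of w] sub that by auto
    qed (use n(2) sub vV in auto)
    then have 1: "partial_coloring m (insert x M) (insert v F)"
    proof (rule partial_coloring_M)
      show "deg x M \<le> c x" using dxA[OF sub(1)] sub False x by simp
      show "deg w M + m x w \<le> c w" if "w \<in> M" "m x w \<noteq> 0" for w
        using that mx[of w] sub False by auto
    qed (use x sub xn in auto)
    show False
    proof (cases "p' \<in> F \<and> q' \<in> F")
      case True
      have "partial_coloring m (insert u (insert x M)) (insert v F)"
      proof (rule partial_coloring_M[OF 1])
        show "deg u (insert x M) \<le> c u"
          using True mem sub x n'(2) cubicD[OF v(2)] by (auto simp: du Int_insert_right)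
        show "deg w (insert x M) + m u w \<le> c w" if "w \<in> insert x M" "m u w \<noteq> 0" for w
        proof -
          have "w = x" using that mu[of w] sub mem True by (auto split: if_splits)
          moreover have "deg x (insert x M) = 0"
            using dxA[of "insert x M"] sub False x xn by auto
          ultimately show ?thesis using mu[OF x(1)] x by simp
        qed
      qed (use vV sub xn v(3) in auto)
      then show False using partial_coloring_proper MF(2) x vV by (auto simp: S_def)
    next
      case F: False
      have "partial_coloring m (insert x M) (insert u (insert v F))"
      proof (rule partial_coloring_F[OF 1 mult])
        show "deg u (insert v F) \<le> 1"
          using F sub vV pn n'(2) xn by (auto simp: du Int_insert_right)
      qed (use vV sub xn v(3) in auto)
      then show False using partial_coloring_proper MF(2) x vV by (auto simp: S_def)
    qed
  next
    case True
    have 0: "partial_coloring m M F"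
      using MF(1) by (rule partial_coloring_add_edge)
    \<comment> \<open>Now \<open>x\<close> goes to \<open>F\<close>, so the temporary edge is given
      up. \<open>v\<close> joins \<open>M\<close> if \<open>p\<close> and \<open>q\<close> are in
      \<open>F\<close>, and \<open>F\<close> otherwise, which leaves \<open>x\<close> at most
      \<open>v\<close> as a neighbor in \<open>F\<close>. Finally \<open>u\<close> uses a reserve,
      or joins \<open>F\<close> when both \<open>p'\<close> and \<open>q'\<close> are in
      \<open>M\<close>.\<close>
    define M1 F1 where "M1 = (if p \<in> F \<and> q \<in> F then insert v M else M)"
      and "F1 = (if p \<in> F \<and> q \<in> F then F else insert v F)"
    have 1: "partial_coloring m M1 F1"
    proof (cases "p \<in> F \<and> q \<in> F")
      case F: True
      have "partial_coloring m (insert v M) F"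
      proof (rule partial_coloring_M[OF 0])
        show "deg v M \<le> c v" using F mem sub cubicD[OF v(1)] by (auto simp: dv Int_insert_right)
        show "deg w M + m v w \<le> c w" if "w \<in> M" "m v w \<noteq> 0" for w
          using that mv[of w] sub mem F by (auto split: if_splits)
      qed (use vV sub in auto)
      then show ?thesis using F by (simp add: M1_def F1_def)
    next
      case F: False
      have "partial_coloring m M (insert v F)"
        by (rule partial_coloring_F[OF 0 mult])
          (use F vV sub n(2) in \<open>auto simp: dv Int_insert_right\<close>)
      then show ?thesis using F by (simp only: M1_def F1_def F if_False)
    qed
    have sub1: "M1 \<subseteq> V" "F1 \<subseteq> V" "x \<notin> M1" "x \<notin> F1" "u \<notin> M1" "u \<notin> F1" "y \<notin> F1"
      using sub vV xn v(3) mem True by (auto simp: M1_def F1_def)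
    have 2: "partial_coloring m M1 (insert x F1)"
    proof (rule partial_coloring_F[OF 1 mult])
      show "deg x F1 \<le> 1" using dxA[OF sub1(2)] sub1 by simp
    qed (use x sub1 in auto)
    have mem1: "p' \<in> M1 \<longleftrightarrow> p' \<in> M" "q' \<in> M1 \<longleftrightarrow> q' \<in> M"
      using pn by (auto simp: M1_def)
    have "M1 \<union> F1 = insert v (M \<union> F)" by (auto simp: M1_def F1_def)
    then have all1: "insert x (insert u (M1 \<union> F1)) = V"
      using MF(2) x vV by (auto simp: S_def)
    show False
    proof (cases "p' \<in> M \<and> q' \<in> M")
      case both: True
      have "partial_coloring m M1 (insert u (insert x F1))"
      proof (rule partial_coloring_F[OF 2 mult])
        have "p' \<notin> F1" "q' \<notin> F1" using both mem pn by (auto simp: F1_def)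
        then show "deg u (insert x F1) \<le> 1"
          using sub1 pn x by (auto simp: du Int_insert_right)
      qed (use vV sub1 xn in auto)
      then show False using partial_coloring_proper all1 by (fastforce simp: insert_commute)
    next
      case one: False
      have "partial_coloring m (insert u M1) (insert x F1)"
      proof (rule partial_coloring_M[OF 2])
        show "deg u M1 \<le> c u"
          using one mem1 sub1 n'(2) cubicD[OF v(2)] by (auto simp: du Int_insert_right)
        show "deg w M1 + m u w \<le> c w" if w: "w \<in> M1" "m u w \<noteq> 0" for w
        proof -
          have w': "w = p' \<or> w = q'" using mu[of w] w sub1 by (auto split: if_splits)
          then have wM: "w \<in> M" using w mem1 by auto
          have "m w v = 0" if "p \<in> F" "q \<in> F"
          proof -
            have "w \<notin> {x, p, q}" using wM sub mem that by auto
            then show ?thesis using mv[of w] wM sub by (auto simp: m_sym[of w v])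
          qed
          then have "deg w M1 = deg w M"
            using sub finite_sub[OF sub(1)] by (auto simp: M1_def)
          moreover have "deg w M + 1 \<le> c w" using MF(4)[OF wM] w' by (auto simp: of_bool_def split: if_splits)
          ultimately show ?thesis using mu[of w] wM w' sub by auto
        qed
      qed (use vV sub1 xn in auto)
      then show False using partial_coloring_proper all1 by (fastforce simp: insert_commute)
    qed
  qed
qed


section \<open>Discharging for \<open>D = 1\<close>\<close>

definition cubics where "cubics = {v. cubic v}"
definition others where "others = V - cubics"

text \<open>
  Every cubic vertex sends a third of its charge 1 to each of its neighbors; the deficit of another
  vertex is \<open>-3\<close> times its resulting charge.
\<close>

definition deficit :: "'a \<Rightarrow> int" where
  "deficit u = 6 * deg u V - 15 - 6 * c u - deg u cubics"

lemma partition: "cubics \<subseteq> V" "others \<subseteq> V" "cubics \<union> others = V" "cubics \<inter> others = {}" "finite cubics" "finite others"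
proof -
  show "cubics \<subseteq> V" "others \<subseteq> V" using cubicD(1) by (auto simp: cubics_def others_def)
  then show "cubics \<union> others = V" "cubics \<inter> others = {}" "finite cubics" "finite others"
    using finite_sub by (auto simp: others_def)
qed

lemma deg_cubics_others: "deg u V = deg u cubics + deg u others"
  using deg_in_Un[OF partition(5,6,4)] partition(3) by simp

lemma deg_cubic_cubics: "cubic v \<Longrightarrow> deg v cubics = 0"
  unfolding deg_in_def cubics_def by (rule sum.neutral) (auto intro: cubic_independent)

text \<open>Sending charge preserves its total, which is \<open>pot V = - 1\<close>, and cubic
  vertices end with charge 0; the factor \<open>-3\<close> turns the total into 3.\<close>

lemma sum_deficit: "sum deficit others = 3"
proof -
  have "deg v others = 3" if "v \<in> cubics" for v
  proof -
    have "cubic v" using that by (simp add: cubics_def)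
    then show ?thesis using deg_cubics_others[of v] deg_cubic_cubics[of v] by (simp add: cubic_def)
  qed
  then have "(\<Sum>v\<in>cubics. deg v others) = (\<Sum>v\<in>cubics. 3)" by (intro sum.cong) auto
  then have 1: "(\<Sum>u\<in>others. deg u cubics) = 3 * int (card cubics)"
    using cross_sym[OF mult, of cubics others] by (simp add: cross_def)
  have "sum charge V = sum charge cubics + sum charge others"
    using sum.union_disjoint[OF partition(5,6,4), of charge] unfolding partition(3) .
  moreover have "sum charge V = - 1" using pot_V potential_sum_charge[of D m c V] by linarith
  moreover have "charge v = 1" if "v \<in> cubics" for v
    using that D_eq_1 by (simp add: cubics_def cubic_def)
  then have "sum charge cubics = (\<Sum>v\<in>cubics. 1)" by (intro sum.cong) auto
  ultimately have 2: "sum charge others = - 1 - int (card cubics)" by simp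
  have "deficit u = - 3 * charge u - deg u cubics" for u
    by (simp add: deficit_def D_eq_1)
  then have "sum deficit others = (\<Sum>u\<in>others. - 3 * charge u - deg u cubics)" by simp
  also have "\<dots> = (\<Sum>u\<in>others. - 3 * charge u) - (\<Sum>u\<in>others. deg u cubics)"
    by (rule sum_subtractf)
  also have "(\<Sum>u\<in>others. - 3 * charge u) = - 3 * sum charge others"
    by (rule sum_distrib_left[symmetric])
  finally have "sum deficit others = - 3 * sum charge others - (\<Sum>u\<in>others. deg u cubics)" .
  then show ?thesis using 1 2 by linarith
qed

lemma cubic_neighbor_set:
  assumes u: "u \<in> V" and N: "N = {v \<in> cubics. m u v = 1}"
  shows "deg u cubics = int (card N)" "\<And>v. v \<in> cubics \<Longrightarrow> m u v = (if v \<in> N then 1 else 0)"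
proof -
  have 01: "m u v = 0 \<or> m u v = 1" if "v \<in> cubics" for v
  proof -
    have "cubic v" using that by (simp add: cubics_def)
    then obtain S where "neighbors v S" using cubic_neighbors by metis
    then show ?thesis using neighborsD[OF _ u] by (auto simp: m_sym[of u v])
  qed
  then show 2: "m u v = (if v \<in> N then 1 else 0)" if "v \<in> cubics" for v using that N by auto
  have "deg u cubics = (\<Sum>v\<in>cubics. if v \<in> N then 1 else 0)"
    unfolding deg_in_def by (rule sum.cong) (use 2 in auto)
  also have "\<dots> = int (card (cubics \<inter> N))" using partition(5) by (simp add: sum.If_cases Int_def)
  also have "cubics \<inter> N = N" using N by auto
  finally show "deg u cubics = int (card N)" .
qed

lemma cubic_neighbors_3:
  assumes u: "u \<in> V" "c u = 1" "deg u V = 4"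
  shows "deg u cubics \<le> 3"
proof (rule ccontr)
  assume "\<not> ?thesis"
  then have d: "deg u cubics = 4" "deg u others = 0" using u deg_cubics_others[of u] deg_nonneg[of u others] by auto
  define N where "N = {v \<in> cubics. m u v = 1}"
  note N = cubic_neighbor_set[OF u(1) N_def]
  have "card N = 4" using N(1) d by simp
  moreover have "finite N" using partition(5) by (simp add: N_def)
  ultimately obtain xs where xs: "set xs = N" "distinct xs" "length xs = 4"
    using finite_distinct_list distinct_card by metis
  then obtain v1 v2 v3 v4 where "xs = [v1, v2, v3, v4]"
    by (auto simp: numeral_eq_Suc length_Suc_conv)
  then have v: "N = {v1, v2, v3, v4}" "distinct [v1, v2, v3, v4]" using xs by auto
  have "m u y = 0" if "y \<in> others" for y
    using d(2) deg_in_eq_0_iff[OF mult partition(6)] that by blast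
  moreover have "y \<notin> N" if "y \<in> others" for y using that partition(4) by (auto simp: N_def)
  moreover have "N \<subseteq> V" using partition(1) by (auto simp: N_def)
  ultimately have "neighbors u N"
    using N(2) partition(3) unfolding neighbors_def by (metis Un_iff)
  moreover have cN: "cubic w" if "w \<in> N" for w using that by (simp add: N_def cubics_def)
  have "cubic v1" "cubic v2" "cubic v3" "cubic v4" by (rule cN, simp add: v(1))+
  ultimately show False
    using not_four_cubic_neighbors[OF u(1,2) _ v(2)] unfolding v(1) by blast
qed

text \<open>Capacity 1 with degree 4, capacity 0 with degree 3, and everything else; a single vertex
  of the last kind would use up the total deficit 3. Nonnegativity in the first case is the
  exclusion of four cubic neighbors.\<close>

lemma deficit_cases:
  assumes u: "u \<in> others"
  obtains (four) "c u = 1" "deg u V = 4" "deficit u = 3 - deg u cubics" "deficit u = deg u others - 1"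
      "0 \<le> deficit u"
    | (three) "deficit u = deg u others" "0 \<le> deficit u"
    | (large) "3 \<le> deficit u"
proof -
  have uV: "u \<in> V" using u by (simp add: others_def)
  have dA: "deg u cubics \<le> deg u V" using deg_cubics_others[of u] deg_nonneg[of u others] by simp
  consider "c u = 1" | "c u = 0" | "c u = - 1" using caps[OF uV] D_eq_1 by fastforce
  then show thesis
  proof cases
    case 1
    have "deg u V \<noteq> 3" using u 1 uV by (auto simp: others_def cubics_def cubic_def)
    then have "deg u V = 4 \<or> 5 \<le> deg u V" using min_degree[OF uV] 1 by auto
    then show thesis
    proof
      assume 4: "deg u V = 4"
      then show thesis
        using four 1 cubic_neighbors_3[OF uV 1 4] deg_cubics_others[of u] by (simp add: deficit_def)
    next
      assume "5 \<le> deg u V"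
      then show thesis using large 1 dA by (simp add: deficit_def)
    qed
  next
    case 2
    then have "deg u V = 3 \<or> 4 \<le> deg u V" using min_degree[OF uV] by auto
    then show thesis
    proof
      assume "deg u V = 3"
      then show thesis
        using three 2 deg_cubics_others[of u] deg_nonneg[of u others] by (simp add: deficit_def)
    next
      assume "4 \<le> deg u V"
      then show thesis using large 2 dA by (simp add: deficit_def)
    qed
  next
    case 3
    have "m u v = 0" if "v \<in> cubics" for v
      using cubic_neighbor_cap[of v u] that uV 3 m_sym[of u v] by (auto simp: cubics_def)
    then have "deg u cubics = 0" unfolding deg_in_def by (intro sum.neutral) auto
    then show thesis using large 3 min_degree[OF uV] by (simp add: deficit_def)
  qed
qed

lemma deficit_nonneg: "u \<in> others \<Longrightarrow> 0 \<le> deficit u"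
  by (erule deficit_cases) auto

lemma sum_deficit_le: "X \<subseteq> others \<Longrightarrow> sum deficit X \<le> 3"
  using sum_mono2[OF partition(6), of X deficit] deficit_nonneg sum_deficit by auto

text \<open>Otherwise the independent set \<open>cubics\<close> could serve as \<open>M\<close>.
  \<open>X\<close> is a smallest violation of the forest bound: removing a vertex with at most one
  edge to the rest would leave a smaller violation.\<close>

lemma dense_subset:
  obtains X where "X \<subseteq> others" "2 \<le> card X" "\<And>x. x \<in> X \<Longrightarrow> 2 \<le> deg x X"
proof -
  have "\<not> forest_on m others"
  proof
    assume "forest_on m others"
    then have "partial_coloring m cubics others"
      using partition deg_cubic_cubics cubicD(2) by (auto simp: partial_coloring_def cubics_def)
    then show False using partial_coloring_proper partition(3) by blast
  qed
  then have "\<exists>n X. X \<subseteq> others \<and> X \<noteq> {} \<and> 2 * int (card X) - 2 < deg_sum m X \<and> card X = n"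
    by (auto simp: forest_on_def not_le)
  then obtain X where X: "X \<subseteq> others" "X \<noteq> {}" "2 * int (card X) - 2 < deg_sum m X"
    and min: "\<And>Y. Y \<subseteq> others \<Longrightarrow> Y \<noteq> {} \<Longrightarrow> 2 * int (card Y) - 2 < deg_sum m Y \<Longrightarrow> card X \<le> card Y"
    using exists_least_iff[of "\<lambda>n. \<exists>X. X \<subseteq> others \<and> X \<noteq> {} \<and> 2 * int (card X) - 2 < deg_sum m X \<and> card X = n"]
    by (metis not_less)
  have fX: "finite X" using X(1) partition(6) by (rule finite_subset)
  have c1: "card X \<noteq> 1"
  proof
    assume "card X = 1"
    then obtain x where "X = {x}" by (auto simp: card_1_singleton_iff)
    then show False using X(3) by (simp add: deg_sum_def cross_def)
  qed
  have "0 < card X" using X(2) fX by (simp add: card_gt_0_iff)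
  then have c2: "2 \<le> card X" using c1 by simp
  have "2 \<le> deg x X" if x: "x \<in> X" for x
  proof -
    let ?Y = "X - {x}"
    have Y: "X = insert x ?Y" "x \<notin> ?Y" "finite ?Y" using x fX by auto
    have cY: "card X = card ?Y + 1" using x fX c2 by simp
    have "?Y \<noteq> {}" using cY c2 by (metis Suc_1 Suc_n_not_le_n add_0 card.empty One_nat_def)
    then have "deg_sum m ?Y \<le> 2 * int (card ?Y) - 2"
      using min[of ?Y] X(1) cY by force
    moreover have "deg_sum m X = deg_sum m ?Y + 2 * deg x ?Y"
      using deg_sum_insert[OF mult Y(3,2)] Y(1) by simp
    moreover have "deg x X = deg x ?Y" using deg_in_insert[OF Y(3,2), of m x] Y(1) by simp
    ultimately show ?thesis using X(3) cY by linarith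
  qed
  then show thesis using that X(1) c2 by blast
qed

lemma cubic_pair:
  assumes x: "x \<in> V" "deg x cubics = 2"
  obtains v v' where "cubic v" "cubic v'" "v \<noteq> v'" "m x v = 1" "m x v' = 1"
    "\<And>w. w \<in> cubics \<Longrightarrow> m x w = (if w \<in> {v, v'} then 1 else 0)"
proof -
  define N where "N = {v \<in> cubics. m x v = 1}"
  note N = cubic_neighbor_set[OF x(1) N_def]
  have "card N = 2" using N(1) x by simp
  then obtain v v' where v: "N = {v, v'}" "v \<noteq> v'" by (auto simp: card_2_iff)
  then have "v \<in> N" "v' \<in> N" by auto
  then have vv: "cubic v" "cubic v'" "m x v = 1" "m x v' = 1" by (auto simp: N_def cubics_def)
  show thesis by (rule that[OF vv(1,2) v(2) vv(3,4)]) (use N(2) in \<open>simp only: v(1)\<close>)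
qed

text \<open>This is how a vertex of deficit 0 with a neighbor in \<open>others\<close> looks; its
  neighborhood has the form required by \<open>no_cubic_triangle\<close>.\<close>

lemma triangle_with_pendant:
  assumes r: "r \<in> others" "c r = 1" "deg r cubics = 3" "deg r others = 1" and s: "s \<in> others" "m r s \<noteq> 0"
    and v: "cubic v" "m v r \<noteq> 0" "m v s \<noteq> 0"
  shows False
proof -
  have rV: "r \<in> V" using r(1) partition by auto
  define N where "N = {v \<in> cubics. m r v = 1}"
  note N = cubic_neighbor_set[OF rV N_def]
  have "v \<in> N" using N(2)[of v] v m_sym[of r v] by (auto simp: cubics_def split: if_splits)
  moreover have c3: "card N = 3" using N(1) r by simp
  ultimately have "card (N - {v}) = 2" by simp
  then obtain v1 v2 where v12: "N - {v} = {v1, v2}" "v1 \<noteq> v2" by (auto simp: card_2_iff)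
  then have NN: "N = {v, v1, v2}" "distinct [v, v1, v2]" using \<open>v \<in> N\<close> by auto
  have "deg r others = deg r {s} + deg r (others - {s})" using deg_in_split[OF partition(6), of "{s}"] s by simp
  then have "m r s = 1" "deg r (others - {s}) = 0"
    using r(4) s(2) m_nonneg[of r s] deg_nonneg[of r "others - {s}"] by simp_all
  then have mB: "m r y = (if y = s then 1 else 0)" if "y \<in> others" for y
    using deg_in_eq_0_iff[OF mult, of "others - {s}" r] partition(6) that by auto
  have "neighbors r {v, v1, v2, s}"
    unfolding neighbors_def
  proof (intro conjI ballI)
    show "{v, v1, v2, s} \<subseteq> V" using NN s partition by (auto simp: N_def)
    fix y assume "y \<in> V"
    then consider "y \<in> cubics" | "y \<in> others" using partition by auto
    then show "m r y = (if y \<in> {v, v1, v2, s} then 1 else 0)"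
    proof cases
      case 1
      then have "y \<noteq> s" using s partition by auto
      then show ?thesis using N(2)[OF 1] NN by simp
    next
      case 2
      then have "y \<notin> N" using partition by (auto simp: N_def)
      then show ?thesis using mB[OF 2] NN by auto
    qed
  qed
  moreover have "distinct [v, v1, v2, s]" using NN s partition by (auto simp: N_def)
  moreover have "cubic v1" "cubic v2" using NN by (auto simp: N_def cubics_def)
  ultimately show False using no_cubic_triangle[OF rV r(2)] v by blast
qed


text \<open>Inner degree 2 forces deficit at least 1, so \<open>X\<close> has at most three
  vertices, and some deficit is exactly 1, since otherwise two vertices already exceed the total 3.
  A vertex of deficit 1 has no double edge inside \<open>X\<close>, hence two neighbors there. So
  \<open>X\<close> is a triangle that uses up the whole deficit.\<close>

lemma triangle:
  obtains x y z where "x \<in> others" "y \<in> others" "z \<in> others" "distinct [x, y, z]"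
    "m x y = 1" "m x z = 1" "m y z = 1"
    "\<And>w. w \<in> {x, y, z} \<Longrightarrow> c w = 1 \<and> deg w cubics = 2 \<and> deg w others = 2"
    "\<And>w. w \<in> others - {x, y, z} \<Longrightarrow> deficit w = 0"
proof -
  obtain X where X: "X \<subseteq> others" "2 \<le> card X" and dX: "\<And>x. x \<in> X \<Longrightarrow> 2 \<le> deg x X"
    using dense_subset by blast
  have fX: "finite X" using X(1) partition(6) by (rule finite_subset)
  have dB: "deg x X \<le> deg x others" for x by (rule deg_in_mono[OF mult partition(6) X(1)])
  have pos: "1 \<le> deficit x" if x: "x \<in> X" for x
  proof -
    have "2 \<le> deg x others" using dX[OF x] dB[of x] by linarith
    moreover have "x \<in> others" using x X by auto
    ultimately show ?thesis by (auto elim: deficit_cases)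
  qed
  have sum3: "sum deficit X \<le> 3" by (rule sum_deficit_le[OF X(1)])
  have card3: "card X \<le> 3"
    using sum_mono[of X "\<lambda>_. 1" deficit] pos sum3 by simp
  have pair: False if x: "x \<in> X" "deficit x = 1" and y: "y \<in> X" "2 \<le> m x y" for x y
  proof -
    have xB: "x \<in> others" using x X by auto
    have four: "c x = 1 \<and> deg x V = 4 \<and> deg x cubics = 2 \<and> deg x others = 2"
      using xB x dX[OF x(1)] dB[of x] by (auto elim: deficit_cases)
    have "m x y \<le> deg x others" using y X by (intro deg_in_ge_mult[OF mult partition(6)]) auto
    then have my: "m x y = 2" using y four by simp
    have xV: "x \<in> V" "y \<in> V" using xB y X partition by auto
    obtain v v' where "cubic v" "cubic v'" "v \<noteq> v'" "m x v = 1" "m x v' = 1"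
      using cubic_pair[OF xV(1)] four by blast
    then show False using no_double_edge[of x y v v'] xV my four by blast
  qed
  have simple: "m x y \<le> 1" if "x \<in> X" "deficit x = 1" "y \<in> X" for x y
  proof (rule ccontr)
    assume "\<not> m x y \<le> 1"
    then show False using pair[OF that] by simp
  qed
  have triple: "card X = 3" if x: "x \<in> X" "deficit x = 1" for x
  proof -
    have "deg x (X - {x}) = deg x X"
      using deg_in_insert[of "X - {x}" x m x] fX x by (simp add: insert_absorb)
    moreover have "deg x (X - {x}) \<le> (\<Sum>y\<in>X - {x}. 1)"
      unfolding deg_in_def by (rule sum_mono) (use simple x in auto)
    ultimately have "2 \<le> card (X - {x})" using dX[OF x(1)] by simp
    then show ?thesis using card3 x fX by simp
  qed
  have "\<exists>x\<in>X. deficit x = 1"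
  proof (rule ccontr)
    assume "\<not> ?thesis"
    then have "2 \<le> deficit x" if "x \<in> X" for x using pos[OF that] that by force
    then have "2 * int (card X) \<le> sum deficit X"
      using sum_mono[of X "\<lambda>_. 2" deficit] by simp
    then show False using sum3 X(2) by simp
  qed
  then have c3: "card X = 3" using triple by blast
  have one: "deficit x = 1" if x: "x \<in> X" for x
  proof -
    have "(\<Sum>y\<in>X - {x}. 1) \<le> sum deficit (X - {x})" by (rule sum_mono) (use pos in auto)
    moreover have "sum deficit X = deficit x + sum deficit (X - {x})" using sum.remove[OF fX x] .
    ultimately show ?thesis using sum3 c3 pos[OF x] x fX by simp
  qed
  obtain x y z where xyz: "X = {x, y, z}" "distinct [x, y, z]"
    using c3 by (auto simp: card_3_iff)
  have xX: "x \<in> X" "y \<in> X" "z \<in> X" using xyz by auto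
  have "deg x X = m x y + m x z" "deg y X = m y x + m y z"
    using xyz by simp_all
  moreover have "m x y \<le> 1" "m x z \<le> 1" "m y x \<le> 1" "m y z \<le> 1"
    using simple one xX by auto
  ultimately have mm: "m x y = 1" "m x z = 1" "m y z = 1"
    using dX[OF xX(1)] dX[OF xX(2)] by linarith+
  have "c w = 1 \<and> deg w cubics = 2 \<and> deg w others = 2" if "w \<in> {x, y, z}" for w
  proof -
    have w: "w \<in> X" "w \<in> others" using that xyz X by auto
    show ?thesis using w(2) one[OF w(1)] dX[OF w(1)] dB[of w] by (auto elim: deficit_cases)
  qed
  moreover have "deficit w = 0" if "w \<in> others - {x, y, z}" for w
  proof -
    have w: "w \<in> others" "w \<notin> X" using that xyz by auto
    have "sum deficit (insert w X) \<le> 3" using w X by (intro sum_deficit_le) auto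
    then have "deficit w + sum deficit X \<le> 3" using w fX by simp
    moreover have "sum deficit X = 3" using sum.cong[of X X deficit "\<lambda>_. 1"] one c3 by simp
    ultimately show ?thesis using deficit_nonneg[OF w(1)] by simp
  qed
  ultimately show thesis using that[of x y z] xX X(1) xyz(2) mm by blast
qed

text \<open>
  Exchanging \<open>x\<close> and \<open>v\<close> in the partition into cubic and other vertices gives a coloring
  unless the other two neighbors of \<open>v\<close> are adjacent.
\<close>

lemma triangle_cubic_neighbor:
  assumes B: "x \<in> others" "y \<in> others" "z \<in> others" "distinct [x, y, z]"
    and e: "m x y = 1" "m x z = 1" "m y z = 1"
    and w: "\<And>w. w \<in> {x, y, z} \<Longrightarrow> c w = 1 \<and> deg w cubics = 2 \<and> deg w others = 2"
    and d0: "\<And>w. w \<in> others - {x, y, z} \<Longrightarrow> deficit w = 0"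
    and v: "cubic v" "m x v \<noteq> 0"
  shows "neighbors v {x, y, z}"
proof -
  have xV: "x \<in> V" using B partition by auto
  have vA: "v \<in> cubics" "v \<in> V" "v \<notin> others" using v partition by (auto simp: cubics_def)
  have vx: "m v x \<noteq> 0" using v by (simp add: m_sym)
  obtain r s where n: "neighbors v {x, r, s}" "distinct [v, x, r, s]" "r \<in> V" "s \<in> V"
    using cubic_other_neighbors[OF v(1) xV vx] .
  have "r \<notin> cubics" "s \<notin> cubics" using cubic_not_neighbor[OF v(1) _ n(1)] by (auto simp: cubics_def)
  then have rs: "r \<in> others" "s \<in> others" using n partition by auto
  have mv1: "m v r = 1" "m v s = 1" "m v x = 1"
    using neighborsD[OF n(1)] n xV by auto
  have low: "deg w (others - {x}) \<le> 1" if wB: "w \<in> others - {x}" for w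
  proof (cases "w \<in> {y, z}")
    case True
    then have "m w x = 1" using e by (auto simp: m_sym)
    moreover have "deg w others = deg w {x} + deg w (others - {x})"
      using deg_in_split[OF partition(6), of "{x}"] B by simp
    ultimately show ?thesis using True assms(8)[of w] by auto
  next
    case False
    have "deg w (others - {x}) \<le> deg w others" by (rule deg_in_mono[OF mult partition(6)]) auto
    moreover have "w \<in> others" "deficit w = 0" using wB False d0 by auto
    then have "deg w others \<le> 1" by (auto elim: deficit_cases)
    ultimately show ?thesis by simp
  qed
  have adj: "m r s \<noteq> 0"
  proof
    assume 0: "m r s = 0"
    have rsn: "r \<noteq> s" using n by auto
    have dA: "deg u (cubics - {v}) = 0" if "u \<in> cubics" for u
    proof -
      have "deg u (cubics - {v}) \<le> deg u cubics" by (rule deg_in_mono[OF mult partition(5)]) auto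
      then show ?thesis using deg_cubic_cubics[of u] that deg_nonneg[of u "cubics - {v}"] by (simp add: cubics_def)
    qed
    \<comment> \<open>The edge \<open>rs\<close> stands for the path through \<open>v\<close> after
      the exchange. In its new class \<open>x\<close> keeps only one cubic neighbor.\<close>
    have "forest_on (add_edge r s m) (others - {x})"
      using forest_on_add_edge_max_degree_1[OF mult _ low 0 rsn] partition(6) by simp
    then have "partial_coloring (add_edge r s m) (cubics - {v}) (others - {x})"
      using partition dA cubicD(2) by (auto simp: partial_coloring_def cubics_def)
    then have "partial_coloring m (cubics - {v}) (insert v (others - {x}))"
    proof (rule partial_coloring_F_edge[OF _ mult rsn])
      show "m v u \<le> of_bool (u = r) + of_bool (u = s)" if "u \<in> others - {x}" for u
        using that neighborsD[OF n(1), of u] partition by auto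
    qed (use vA in auto)
    then have "partial_coloring m (insert x (cubics - {v})) (insert v (others - {x}))"
    proof (rule partial_coloring_M)
      have "deg x cubics = m x v + deg x (cubics - {v})"
        using deg_in_split[OF partition(5), of "{v}" m x] vA by simp
      then show "deg x (cubics - {v}) \<le> c x" using assms(8)[of x] mv1 by (simp add: m_sym[of x v])
      show "deg u (cubics - {v}) + m x u \<le> c u" if "u \<in> cubics - {v}" "m x u \<noteq> 0" for u
      proof -
        have "cubic u" "m u x \<noteq> 0" using that by (simp_all add: cubics_def m_sym)
        then obtain S where "neighbors u S" using cubic_neighbors by metis
        then have "m u x \<le> 1" using neighborsD[OF _ xV] by auto
        then show ?thesis using dA[of u] that cubicD(2)[OF \<open>cubic u\<close>] by (simp add: m_sym[of x u])
      qed
    qed (use xV B vA partition in auto)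
    moreover have "insert x (cubics - {v}) \<union> insert v (others - {x}) = V" using B vA partition by auto
    ultimately show False using partial_coloring_proper by blast
  qed
  \<comment> \<open>Outside the triangle \<open>xyz\<close>, an end of the edge \<open>rs\<close>
    has deficit 0 and would form a triangle with \<open>v\<close>, against
    \<open>triangle_with_pendant\<close>.\<close>
  have inner: "r \<in> {y, z}" if r: "r \<in> others" "s \<in> others" "m r s \<noteq> 0" "m v r = 1" "m v s = 1" "r \<noteq> x" for r s
  proof (rule ccontr)
    assume "r \<notin> {y, z}"
    then have "deficit r = 0" using r d0 by auto
    moreover have "m r s \<le> deg r others" by (rule deg_in_ge_mult[OF mult partition(6) r(2)])
    then have "1 \<le> deg r others" using r m_nonneg[of r s] by linarith
    ultimately have "c r = 1 \<and> deg r cubics = 3 \<and> deg r others = 1"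
      using r(1) by (auto elim: deficit_cases)
    then show False using triangle_with_pendant[OF r(1) _ _ _ r(2,3) v(1)] r by auto
  qed
  have "r \<in> {y, z}" using inner[of r s] rs adj mv1 n by auto
  moreover have "s \<in> {y, z}" using inner[of s r] rs adj mv1 n by (auto simp: m_sym)
  ultimately have "{x, r, s} = {x, y, z}" using n(2) by auto
  then show ?thesis using n(1) by simp
qed

text \<open>Both cubic neighbors of \<open>x\<close> are adjacent to all of \<open>x\<close>,
  \<open>y\<close>, \<open>z\<close>. The five vertices thus form a complete graph minus the edge
  \<open>vv'\<close>, of potential \<open>5 * 7 - 4 * 9 = -1\<close>, so by the gap they are all of
  \<open>V\<close>. This graph is colorable with the edge \<open>yz\<close> as \<open>M\<close> and
  the path \<open>v\<close>, \<open>x\<close>, \<open>v'\<close> as \<open>F\<close>.\<close>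

lemma contradiction: False
proof -
  obtain x y z where B: "x \<in> others" "y \<in> others" "z \<in> others" "distinct [x, y, z]"
    and e: "m x y = 1" "m x z = 1" "m y z = 1"
    and w: "\<And>w. w \<in> {x, y, z} \<Longrightarrow> c w = 1 \<and> deg w cubics = 2 \<and> deg w others = 2"
    and d0: "\<And>w. w \<in> others - {x, y, z} \<Longrightarrow> deficit w = 0"
    using triangle by metis
  have V: "x \<in> V" "y \<in> V" "z \<in> V" using B partition by auto
  have cw: "c x = 1" "c y = 1" "c z = 1" using w by auto
  have "deg x cubics = 2" using w by auto
  then obtain v v' where v: "cubic v" "cubic v'" "v \<noteq> v'" "m x v = 1" "m x v' = 1"
    using cubic_pair[OF V(1)] by metis
  have n: "neighbors v {x, y, z}" "neighbors v' {x, y, z}"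
    using triangle_cubic_neighbor[OF B e w d0 v(1)] triangle_cubic_neighbor[OF B e w d0 v(2)] v
    by auto
  have vV: "v \<in> V" "v' \<in> V" using v cubicD by auto
  have vn: "v \<notin> {x, y, z}" "v' \<notin> {x, y, z}" using neighbors_irrefl n by auto
  have mv: "m v u = 1" "m v' u = 1" if "u \<in> {x, y, z}" for u
    using neighborsD[OF n(1), of u] neighborsD[OF n(2), of u] that V by auto
  have vv: "m v' v = 0" by (rule cubic_independent[OF v(2,1)])
  have s: "m y x = 1" "m z x = 1" "m z y = 1" using e by (simp_all add: m_sym)
  have dist: "x \<noteq> y" "x \<noteq> z" "y \<noteq> z" using B(4) by auto
  have p1: "pot {x} = 7" using pot_insert_1[of "{}" x] cw by simp
  have p2: "pot {y, x} = 10" using pot_insert_1[of "{x}" y] cw dist p1 s by simp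
  have p3: "pot {z, y, x} = 9" using pot_insert_1[of "{y, x}" z] cw dist p2 s by simp
  have p4: "pot {v, z, y, x} = 4"
    using pot_insert_1[of "{z, y, x}" v] cubicD(2)[OF v(1)] dist p3 vn mv by simp
  have p5: "pot {v', v, z, y, x} = - 1"
    using pot_insert_1[of "{v, z, y, x}" v'] cubicD(2)[OF v(2)] dist p4 vn mv v(3) vv by simp
  have "\<not> {v', v, z, y, x} \<subset> V" using gap3[of "{v', v, z, y, x}"] p5 by auto
  then have all: "{v', v, z, y, x} = V" using V vV by auto
  have "partial_coloring m {} {}" by (simp add: partial_coloring_def)
  then have "partial_coloring m {} {x}"
    by (rule partial_coloring_F[OF _ mult]) (use V in auto)
  then have "partial_coloring m {} {v, x}"
    by (rule partial_coloring_F[OF _ mult]) (use vV vn mv in auto)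
  then have "partial_coloring m {} {v', v, x}"
    by (rule partial_coloring_F[OF _ mult]) (use vV vn mv v(3) vv in auto)
  then have "partial_coloring m {y} {v', v, x}"
    by (rule partial_coloring_M) (use V vn cw dist in auto)
  then have "partial_coloring m {z, y} {v', v, x}"
    by (rule partial_coloring_M) (use V vn cw dist e s in auto)
  then show False using partial_coloring_proper all by force
qed

end

theorem sparse_colorable:
  fixes V :: "'a set"
  assumes "finite V" "multiplicity m" "1 \<le> D"
    and "\<And>v. v \<in> V \<Longrightarrow> - 1 \<le> c v \<and> c v \<le> D"
    and "\<And>A. A \<subseteq> V \<Longrightarrow> A \<noteq> {} \<Longrightarrow> - 1 \<le> potential D m c A"
  shows "\<exists>M. coloring V m c M"
  using assms
proof (induction "card V" arbitrary: V m c rule: less_induct)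
  case less
  show ?case
  proof (rule ccontr)
    assume nc: "\<not> ?case"
    have "minimal_counterexample V m c D"
    proof
      show "- 1 \<le> potential D m c A" if "A \<subseteq> V" for A
        using less.prems(5)[OF that] by (cases "A = {}") auto
      show "\<exists>M. coloring V' m' c' M"
        if "card V' < card V" "finite V'" "multiplicity m'"
          "\<And>v. v \<in> V' \<Longrightarrow> - 1 \<le> c' v \<and> c' v \<le> D"
          "\<And>A. A \<subseteq> V' \<Longrightarrow> A \<noteq> {} \<Longrightarrow> - 1 \<le> potential D m' c' A"
        for V' :: "'a set" and m' c'
        using less.hyps[of V' m' c'] that less.prems(3) by blast
    qed (use less.prems nc in auto)
    then show False by (rule minimal_counterexample.contradiction)
  qed
qed

section \<open>Multigraphs\<close>

definition edge_mult :: "('v, 'e) mgraph \<Rightarrow> 'v \<Rightarrow> 'v \<Rightarrow> int" where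
  "edge_mult G x y = int (card {e \<in> edges G. ends G e = {x, y}})"

context multigraph
begin

lemma multiplicity_edge_mult: "multiplicity (edge_mult G)"
proof -
  have "{e \<in> edges G. ends G e = {x}} = {}" for x
  proof (rule equals0I)
    fix e assume "e \<in> {e \<in> edges G. ends G e = {x}}"
    then show False using loopless[of e] by simp
  qed
  then have "edge_mult G x x = 0" for x by (simp only: edge_mult_def insert_absorb2) simp
  then show ?thesis by (simp add: multiplicity_def) (simp add: edge_mult_def insert_commute)
qed

lemma deg_sum_edge_mult:
  assumes "finite A"
  shows "deg_sum (edge_mult G) A = 2 * int (card (edges (induced G A)))"
proof -
  have edge: "(\<Sum>x\<in>A. \<Sum>y\<in>A. of_bool (ends G e = {x, y})) = 2 * (of_bool (ends G e \<subseteq> A) :: int)"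
    if e: "e \<in> edges G" for e
  proof -
    obtain a b where ab: "ends G e = {a, b}" "a \<noteq> b"
      using loopless[OF e] by (auto simp: card_2_iff)
    have "(\<Sum>y\<in>A. of_bool (ends G e = {x, y})) =
        (of_bool (x = a \<and> b \<in> A) + of_bool (x = b \<and> a \<in> A) :: int)" for x
    proof -
      have "of_bool (ends G e = {x, y}) =
          (of_bool (x = a \<and> y = b) + of_bool (x = b \<and> y = a) :: int)" for y
        using ab by (auto simp: doubleton_eq_iff)
      then have "(\<Sum>y\<in>A. of_bool (ends G e = {x, y})) =
          (\<Sum>y\<in>A. of_bool (x = a \<and> y = b) + of_bool (x = b \<and> y = a) :: int)" by simp
      also have "\<dots> = of_bool (x = a \<and> b \<in> A) + of_bool (x = b \<and> a \<in> A)"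
        using assms ab(2) by (cases "x = a"; cases "x = b") (simp_all add: sum.distrib of_bool_def)
      finally show ?thesis .
    qed
    then have "(\<Sum>x\<in>A. \<Sum>y\<in>A. of_bool (ends G e = {x, y})) =
        (\<Sum>x\<in>A. of_bool (x = a \<and> b \<in> A) + of_bool (x = b \<and> a \<in> A) :: int)" by simp
    also have "\<dots> = 2 * of_bool (ends G e \<subseteq> A)"
      using assms ab by (cases "a \<in> A"; cases "b \<in> A") (simp_all add: sum.distrib of_bool_def)
    finally show ?thesis .
  qed
  have "edge_mult G x y = (\<Sum>e\<in>edges G. of_bool (ends G e = {x, y}))" for x y
    using finite_edges by (simp add: edge_mult_def of_bool_def sum.If_cases Int_def)
  then have "deg_sum (edge_mult G) A =
      (\<Sum>x\<in>A. \<Sum>y\<in>A. \<Sum>e\<in>edges G. of_bool (ends G e = {x, y}))"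
    by (simp only: deg_sum_def cross_def deg_in_def)
  also have "\<dots> = (\<Sum>x\<in>A. \<Sum>e\<in>edges G. \<Sum>y\<in>A. of_bool (ends G e = {x, y}))"
    by (rule sum.cong[OF refl], rule sum.swap)
  also have "\<dots> = (\<Sum>e\<in>edges G. \<Sum>x\<in>A. \<Sum>y\<in>A. of_bool (ends G e = {x, y}))"
    by (rule sum.swap)
  also have "\<dots> = (\<Sum>e\<in>edges G. 2 * of_bool (ends G e \<subseteq> A))"
    by (rule sum.cong[OF refl]) (rule edge)
  also have "\<dots> = 2 * int (card (edges (induced G A)))"
    using finite_edges
    by (simp add: induced_def of_bool_def sum.If_cases Int_def flip: sum_distrib_left)
  finally show ?thesis .
qed

lemma degree_induced_le:
  assumes "finite M"
  shows "int (degree (induced G M) v) \<le> deg_in (edge_mult G) v M"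
proof -
  have "{e \<in> edges (induced G M). v \<in> ends (induced G M) e}
      \<subseteq> (\<Union>y\<in>M. {e \<in> edges G. ends G e = {v, y}})"
  proof
    fix e assume "e \<in> {e \<in> edges (induced G M). v \<in> ends (induced G M) e}"
    then have e: "e \<in> edges G" "ends G e \<subseteq> M" "v \<in> ends G e" by (auto simp: induced_def)
    then obtain a b where "ends G e = {a, b}"
      using loopless[OF e(1)] by (auto simp: card_2_iff)
    then obtain y where "ends G e = {v, y}"
      using e(3) by (cases "v = a") (auto simp: insert_commute)
    then show "e \<in> (\<Union>y\<in>M. {e \<in> edges G. ends G e = {v, y}})" using e by auto
  qed
  then have "degree (induced G M) v \<le> card (\<Union>y\<in>M. {e \<in> edges G. ends G e = {v, y}})"
    unfolding degree_def using assms finite_edges by (intro card_mono) auto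
  also have "\<dots> \<le> (\<Sum>y\<in>M. card {e \<in> edges G. ends G e = {v, y}})"
    by (rule card_UN_le[OF assms])
  finally show ?thesis by (simp add: deg_in_def edge_mult_def flip: of_nat_sum)
qed

text \<open>A cycle puts as many distinct edges as vertices into its vertex set, one more than
  \<open>forest_on\<close> permits.\<close>

lemma forest_induced:
  assumes "finite X" "forest_on (edge_mult G) X"
  shows "forest (induced G X)"
  unfolding forest_def
proof safe
  fix vs es assume c: "is_cycle (induced G X) vs es"
  define Y where "Y = set vs"
  have Y: "Y \<subseteq> X" "Y \<noteq> {}" "finite Y" using c by (auto simp: is_cycle_def Y_def induced_def)
  have "set es \<subseteq> edges (induced G Y)"
  proof
    fix e assume e: "e \<in> set es"
    then obtain i where i: "i < length vs" "e = es ! i"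
      using c by (auto simp: in_set_conv_nth is_cycle_def)
    have "Suc i mod length vs < length vs" using i by (intro mod_less_divisor) auto
    then have "ends G e \<subseteq> Y" using c i by (auto simp: is_cycle_def induced_def Y_def)
    then show "e \<in> edges (induced G Y)" using c e by (auto simp: is_cycle_def induced_def)
  qed
  moreover have "finite (edges (induced G Y))" using finite_edges by (simp add: induced_def)
  ultimately have "card (set es) \<le> card (edges (induced G Y))" by (rule card_mono[rotated])
  moreover have "card (set es) = card Y"
    using c by (simp add: is_cycle_def Y_def distinct_card)
  ultimately have "2 * int (card Y) \<le> deg_sum (edge_mult G) Y"
    by (simp add: deg_sum_edge_mult[OF Y(3)])
  then show False using assms(2) Y by (auto simp: forest_on_def)
qed

text \<open>Multiplying by \<open>2 * (D + 1)\<close> clears the denominators. Singletons lie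
  outside the scope of \<open>sparse\<close>, but they span no edges.\<close>

lemma potential_edge_mult:
  fixes D :: nat
  assumes "sparse ((4 * real D + 3) / (2 * (real D + 1))) (1 / (2 * (real D + 1))) G"
    and A: "A \<subseteq> verts G" "A \<noteq> {}"
  shows "- 1 \<le> potential (int D) (edge_mult G) (\<lambda>_. int D) A"
proof -
  have fA: "finite A" using A(1) finite_verts by (rule finite_subset)
  define n k where "n = card A" and "k = card (edges (induced G A))"
  have pot: "potential (int D) (edge_mult G) (\<lambda>_. int D) A =
      (4 * int D + 3) * int n - 2 * (int D + 1) * int k"
    by (simp add: potential_def deg_sum_edge_mult[OF fA] n_def k_def algebra_simps)
  show ?thesis
  proof (cases "2 \<le> n")
    case True
    have "real k \<le> (4 * real D + 3) / (2 * (real D + 1)) * real n + 1 / (2 * (real D + 1))"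
      using assms(1) A(1) True by (simp add: sparse_def n_def k_def)
    also have "\<dots> = ((4 * real D + 3) * real n + 1) / (2 * (real D + 1))"
      by (simp add: add_divide_distrib[of "(4 * real D + 3) * real n"])
    finally have "2 * (real D + 1) * real k \<le> (4 * real D + 3) * real n + 1"
      by (simp add: pos_le_divide_eq mult.commute)
    then have "real_of_int (2 * (int D + 1) * int k) \<le> real_of_int ((4 * int D + 3) * int n + 1)"
      by simp
    then have "2 * (int D + 1) * int k \<le> (4 * int D + 3) * int n + 1" by (simp only: of_int_le_iff)
    then show ?thesis unfolding pot by simp
  next
    case False
    have "0 < n" using A(2) fA by (simp add: n_def card_gt_0_iff)
    then have "n = 1" using False by simp
    then obtain x where "A = {x}" by (auto simp: n_def card_1_singleton_iff)
    then have "deg_sum (edge_mult G) A = 0"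
      using multiplicity_diag[OF multiplicity_edge_mult] by (simp add: deg_sum_def cross_def)
    then have "k = 0" using deg_sum_edge_mult[OF fA] by (simp add: k_def)
    then show ?thesis unfolding pot \<open>n = 1\<close> by simp
  qed
qed

end

theorem theorem1p1:
  fixes G :: "('v, 'e) mgraph" and D :: nat
  assumes "D \<ge> 1"
    and "multigraph G"
    and "sparse ((4 * real D + 3) / (2 * (real D + 1))) (1 / (2 * (real D + 1))) G"
  shows "\<exists>M F. is_DF_coloring D G M F"
proof -
  interpret multigraph G by (rule assms(2))
  have "\<exists>M. coloring (verts G) (edge_mult G) (\<lambda>_. int D) M"
    using assms(1) finite_verts multiplicity_edge_mult potential_edge_mult[OF assms(3)]
    by (intro sparse_colorable[where D = "int D"]) auto
  then obtain M where M: "coloring (verts G) (edge_mult G) (\<lambda>_. int D) M" by blast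
  then have MV: "M \<subseteq> verts G" "finite M" "finite (verts G - M)"
    using finite_verts by (auto simp: coloring_def dest: finite_subset)
  have "degree (induced G M) v \<le> D" if "v \<in> M" for v
  proof -
    have "deg_in (edge_mult G) v M \<le> int D" using M that by (simp add: coloring_def)
    then show ?thesis using degree_induced_le[OF MV(2), of v] by linarith
  qed
  then have "max_degree_at_most (induced G M) D"
    by (simp add: max_degree_at_most_def induced_def)
  moreover have "forest (induced G M)" "forest (induced G (verts G - M))"
    using M MV forest_induced by (auto simp: coloring_def)
  ultimately have "is_DF_coloring D G M (verts G - M)"
    using MV(1) by (auto simp: is_DF_coloring_def)
  then show ?thesis by blast
qed

end
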